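(* Let $G$ be a finite group of odd order $n$, let $d=d(G)$ be its discriminant, and let $n^*=(-1)^{\frac{n-1}{2}}\,n$. Then $d=n^*$ and, for any integer $a$, $$\left(\frac{a}{G}\right)=\left(\frac{n^*}{a}\right),$$ where the left side is the quadratic symbol of $G$ and the right side is the Kronecker symbol. Also, the character $\left(\frac{\cdot}{G}\right)$ is trivial if and only if $n$ is a square.
   Context: Let $G$ be a finite group of order $n$ with conjugacy classes $C_1=\{1\}, C_2,\dots,C_m$. Quadratic symbol of $G$: an integer $a$ prime to $n$ acts as a permutation on the set of the $m$ conjugacy classes of $G$ by sending the class of $g$ to the class of $g^a$. For any integer $a$, define $\left(\frac{a}{G}\right)=0$ if $\gcd(a,n)\neq 1$; $\left(\frac{a}{G}\right)=1$ if $\gcd(a,n)=1$ and this permutation is even; $\left(\frac{a}{G}\right)=-1$ if $\gcd(a,n)=1$ and this permutation is odd. This is a real Dirichlet character modulo $n$; "trivial" means that it is the principal character modulo $n$, i.e. it equals $1$ at every integer $a$ with $\gcd(a,n)=1$. Discriminant of $G$: a conjugacy class $C$ is real if $C^{-1}=C$ and complex otherwise, where $C^{-1}$ is the image of $C$ under $g\mapsto g^{-1}$. Complex classes occur in pairs $C\neq C^{-1}$. Order the classes so that the first $r_1$ are the real ones, and let $r_2$ be half the number of complex classes, so $m=r_1+2r_2$. Define $$d=d(G)=(-1)^{r_2}\,|G|^{r_1}\prod_{j=1}^{r_1}|C_j|^{-1},$$ which is a nonzero integer. Kronecker symbol: for a nonzero integer $d$ with $d\equiv 0$ or $1 \pmod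 4$ (squares allowed), $\left(\frac{d}{p}\right)$ for an odd prime $p$ is the Legendre symbol ($0$ if $p\mid d$, $1$ if $p \nmid d$ and $d$ is a square modulo $p$, $-1$ otherwise); $\left(\frac{d}{2}\right)$ is $0$ if $d$ is even, $1$ if $d\equiv 1 \pmod 8$, $-1$ if $d\equiv 5\pmod 8$; $\left(\frac{d}{-1}\right)$ is the sign of $d$ (that is, $\pm1$); $\left(\frac{d}{a}\right)$ is extended to all nonzero integers $a$ by multiplicativity in $a$ (with $\left(\frac{d}{1}\right)=1$); and $\left(\frac{d}{0}\right)=0$ unless $d=1$, in which case $\left(\frac{1}{0}\right)=1$. For $n$ odd and positive, $n^*\equiv 1\pmod 4$, so the symbol $\left(\frac{n^*}{a}\right)$ is defined. *)

theory Defs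
  imports
    "HOL-Algebra.Group_Action"
    "HOL-Number_Theory.Residues"
    "HOL-Combinatorics.Permutations"
begin

section \<open>Conjugacy classes\<close>

definition conj_action :: "('a, 'b) monoid_scheme \<Rightarrow> 'a \<Rightarrow> 'a \<Rightarrow> 'a" where
  "conj_action G = (\<lambda>g. \<lambda>h \<in> carrier G. g \<otimes>\<^bsub>G\<^esub> h \<otimes>\<^bsub>G\<^esub> inv\<^bsub>G\<^esub> g)"

definition conj_class :: "('a, 'b) monoid_scheme \<Rightarrow> 'a \<Rightarrow> 'a set" where
  "conj_class G x = orbit G (conj_action G) x"

definition conj_classes :: "('a, 'b) monoid_scheme \<Rightarrow> 'a set set" where
  "conj_classes G = orbits G (carrier G) (conj_action G)"

text \<open>
  The map induced on classes by \<open>g \<mapsto> g\<^sup>a\<close> is given as an image; \<open>class_pow_conj_class\<close> below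
  shows that it sends the class of \<open>g\<close> to the class of \<open>g\<^sup>a\<close>.
\<close>

definition class_pow :: "('a, 'b) monoid_scheme \<Rightarrow> int \<Rightarrow> 'a set \<Rightarrow> 'a set" where
  "class_pow G a C = (\<lambda>x. x [^]\<^bsub>G\<^esub> a) ` C"

section \<open>The quadratic symbol of a finite group\<close>

definition group_quad_symbol :: "('a, 'b) monoid_scheme \<Rightarrow> int \<Rightarrow> int" where
  "group_quad_symbol G a =
     (if coprime a (int (order G)) then sign_on (conj_classes G) (class_pow G a) else 0)"

section \<open>The discriminant of a finite group\<close>

definition real_classes :: "('a, 'b) monoid_scheme \<Rightarrow> 'a set set" where
  "real_classes G = {C \<in> conj_classes G. set_inv\<^bsub>G\<^esub> C = C}"

definition complex_classes :: "('a, 'b) monoid_scheme \<Rightarrow> 'a set set" where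
  "complex_classes G = {C \<in> conj_classes G. set_inv\<^bsub>G\<^esub> C \<noteq> C}"

definition group_disc :: "('a, 'b) monoid_scheme \<Rightarrow> rat" where
  "group_disc G =
     (let r\<^sub>1 = card (real_classes G); r\<^sub>2 = card (complex_classes G) div 2
      in (-1) ^ r\<^sub>2 * of_nat (order G) ^ r\<^sub>1 * (\<Prod>C\<in>real_classes G. inverse (of_nat (card C))))"

section \<open>The Kronecker symbol\<close>

text \<open>
  Only meaningful for \<open>d \<noteq> 0\<close> with \<open>d \<equiv> 0\<close> or \<open>1\<close> modulo 4, so that an odd \<open>d\<close> is \<open>1\<close> or \<open>5\<close>
  modulo 8.
\<close>

definition kronecker_prime :: "int \<Rightarrow> int \<Rightarrow> int" where
  "kronecker_prime d p =
     (if p = 2 then (if even d then 0 else if d mod 8 = 1 then 1 else -1) else Legendre d p)"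

definition kronecker :: "int \<Rightarrow> int \<Rightarrow> int" where
  "kronecker d a =
     (if a = 0 then (if d = 1 then 1 else 0)
      else (if a < 0 then sgn d else 1) * (\<Prod>p\<in>#prime_factorization a. kronecker_prime d p))"

definition n_star :: "nat \<Rightarrow> int" where
  "n_star n = (-1) ^ ((n - 1) div 2) * int n"

section \<open>Well-definedness\<close>

lemma kronecker_minus_one: "kronecker d (-1) = sgn d"
  by (simp add: kronecker_def prime_factorization_unit)

lemma kronecker_at_prime: "prime p \<Longrightarrow> kronecker d p = kronecker_prime d p"
  using prime_gt_0_int[of p] by (simp add: kronecker_def prime_factorization_prime)

lemma kronecker_mult:
  assumes "d \<noteq> 0" "a \<noteq> 0" "b \<noteq> 0"
  shows "kronecker d (a * b) = kronecker d a * kronecker d b"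
  using assms
  by (auto simp: kronecker_def prime_factorization_mult mult_less_0_iff sgn_if)

context group
begin

lemma conj_class_eq:
  assumes "x \<in> carrier G"
  shows "conj_class G x = (\<lambda>g. g \<otimes> x \<otimes> inv g) ` carrier G"
  using assms by (auto simp: conj_class_def orbit_def conj_action_def)

lemma conj_classes_eq: "conj_classes G = conj_class G ` carrier G"
  by (auto simp: conj_classes_def orbits_def conj_class_def)

lemma conj_nat_pow:
  assumes "g \<in> carrier G" "x \<in> carrier G"
  shows "(g \<otimes> x \<otimes> inv g) [^] (n::nat) = g \<otimes> x [^] n \<otimes> inv g"
proof (induction n)
  case (Suc n)
  have "inv g \<otimes> (g \<otimes> (x \<otimes> inv g)) = x \<otimes> inv g"
    using assms by (simp add: m_assoc [symmetric])
  then show ?case using assms Suc by (simp add: m_assoc)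
qed (use assms in simp)

lemma conj_inv:
  assumes "g \<in> carrier G" "x \<in> carrier G"
  shows "inv (g \<otimes> x \<otimes> inv g) = g \<otimes> inv x \<otimes> inv g"
  using assms by (simp add: inv_mult_group m_assoc)

lemma conj_int_pow:
  assumes "g \<in> carrier G" "x \<in> carrier G"
  shows "(g \<otimes> x \<otimes> inv g) [^] (a::int) = g \<otimes> x [^] a \<otimes> inv g"
  using assms by (cases a rule: int_cases2)
    (simp_all add: int_pow_int conj_nat_pow int_pow_neg conj_inv)

lemma class_pow_conj_class:
  assumes "x \<in> carrier G"
  shows "class_pow G a (conj_class G x) = conj_class G (x [^] a)"
  using assms by (simp add: class_pow_def conj_class_eq image_image conj_int_pow)

lemma class_pow_bij:
  assumes "finite (carrier G)" "coprime a (int (order G))"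
  shows "bij_betw (class_pow G a) (conj_classes G) (conj_classes G)"
proof -
  obtain b where b: "[a * b = 1] (mod int (order G))"
    using assms(2) cong_solve_coprime_int by blast
  then obtain k where k: "a * b = 1 + int (order G) * k"
    by (metis cong_iff_lin cong_sym)
  have inv: "(x [^] a) [^] b = x" if x: "x \<in> carrier G" for x
  proof -
    have "x [^] int (order G) = \<one>"
      using x assms(1) by (simp add: int_pow_int pow_order_eq_1)
    then have "x [^] (int (order G) * k) = \<one>"
      using x by (metis int_pow_pow int_pow_one)
    then show ?thesis using x by (simp add: int_pow_pow k int_pow_mult)
  qed
  then have "(x [^] b) [^] a = x" if "x \<in> carrier G" for x
    using that by (metis int_pow_pow mult.commute)
  with inv show ?thesis
    by (intro bij_betw_byWitness[where f' = "class_pow G b"])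
       (auto simp: conj_classes_eq class_pow_conj_class)
qed

lemma set_inv_conj_class:
  assumes "x \<in> carrier G"
  shows "set_inv (conj_class G x) = conj_class G (inv x)"
  using assms by (auto simp: SET_INV_def conj_class_eq conj_inv)

lemma group_disc_Ints:
  assumes "finite (carrier G)"
  shows "group_disc G \<in> \<int>"
proof -
  interpret conj: group_action G "carrier G" "conj_action G"
    unfolding conj_action_def by (rule action_by_conjugation)
  have "inverse (of_nat (card C)) * of_nat (order G) \<in> (\<int> :: rat set)"
    if C: "C \<in> real_classes G" for C
  proof -
    obtain x where x: "x \<in> carrier G" "C = conj_class G x"
      using C by (auto simp: real_classes_def conj_classes_eq)
    have "card C * card (stabilizer G (conj_action G) x) = order G"
      using conj.orbit_stabilizer_theorem[OF x(1)] x(2) by (simp add: conj_class_def)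
    then have "order G = card C * card (stabilizer G (conj_action G) x)" by simp
    then show ?thesis
      by (cases "card C = 0") (simp_all add: field_simps)
  qed
  then have "(\<Prod>C\<in>real_classes G. inverse (of_nat (card C)) * of_nat (order G)) \<in> (\<int> :: rat set)"
    by (rule Ints_prod)
  then have "(-1) ^ (card (complex_classes G) div 2) *
      (\<Prod>C\<in>real_classes G. inverse (of_nat (card C)) * of_nat (order G)) \<in> (\<int> :: rat set)"
    by (intro Ints_mult Ints_power) simp_all
  then show ?thesis
    by (simp add: group_disc_def Let_def prod.distrib mult_ac)
qed

end

end

theory Submission
  imports Defs "HOL-Number_Theory.Number_Theory" "Jordan_Normal_Form.Determinant"
begin

text \<open>
  Everything rests on the equality \<open>(q/G) = (n\<^sup>*/q)\<close> for odd primes \<open>q\<close> not dividing \<open>n\<close>,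
  lemma \<open>group_quad_symbol_prime\<close>. The ring at work is that of integer class functions
  under convolution, taken modulo \<open>q\<close>. It is commutative, and its Frobenius map \<open>f \<mapsto> f\<^sup>q\<close> is the
  linear map \<open>\<phi>\<close> that sends the indicator of a class \<open>C\<close> to that of \<open>C\<^sup>q\<close> (lemma \<open>frobenius\<close>).
  So the permutation of the classes is read off from \<open>\<phi>\<close>, and the ring has no nilpotents modulo
  \<open>q\<close>.

  In odd order the class of \<open>1\<close> is the only real one. If there are \<open>r\<close> pairs of complex classes, then
  \<open>d(G) = (-1)\<^sup>r n\<close>, which is \<open>n\<^sup>*\<close> because \<open>n\<close> is \<open>1\<close> plus twice a sum of \<open>r\<close> odd class sizes. The
  class functions are, over the rationals, the sum of the symmetric ones, \<open>Z\<^sup>+\<close> of rank \<open>r + 1\<close>, and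
  the antisymmetric ones, \<open>Z\<^sup>-\<close> of rank \<open>r\<close>. Let \<open>s\<close> be the constant function \<open>1\<close> and let \<open>W\<close>
  be spanned by \<open>s\<close> and \<open>Z\<^sup>-\<close>, also of rank \<open>r + 1\<close>. For a suitable antisymmetric \<open>\<iota>\<close> (lemma
  \<open>regular_antisym_fun_exists\<close>) the element \<open>e = s + \<iota>\<close> multiplies \<open>W\<close> injectively modulo \<open>q\<close> into
  \<open>Z\<^sup>+\<close>. Now \<open>\<phi>(e w) = e\<^sup>q \<phi>(w) = e (e\<^sup>2)\<^sup>k \<phi>(w)\<close> with \<open>k = (q - 1)/2\<close>. In the natural bases \<open>\<phi>\<close>
  is a permutation matrix on \<open>Z\<^sup>+\<close> and the same matrix up to signs on \<open>W\<close>; hence the product of the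
  signs is \<open>det(e\<^sup>2 on W)\<^sup>k\<close>, that is, the Legendre symbol of \<open>det(e\<^sup>2 on W)\<close>. The form
  \<open>(f, g) \<mapsto> (f g)(1)\<close> is diagonal in both bases, with determinants whose quotient is \<open>(-1)\<^sup>r n = n\<^sup>*\<close>,
  and \<open>e\<close> carries the form \<open>(v, e\<^sup>2 w)\<close> on \<open>W\<close> to the form on \<open>Z\<^sup>+\<close>; so \<open>det(e\<^sup>2 on W)\<close> is \<open>n\<^sup>*\<close> times
  a square modulo \<open>q\<close> (lemmas \<open>det_cong_if_twisted_similitude\<close> and \<open>prod_pow_sign_cong\<close>). Finally the
  product of the signs is the sign of the permutation of the classes, by the argument of Gauss's lemma
  (lemma \<open>sign_commuting_involution\<close>).

  The rest is arithmetic. By quadratic reciprocity \<open>(n\<^sup>*/q)\<close> is the Jacobi symbol \<open>(q/n)\<close>. Both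
  \<open>(a/G)\<close> and \<open>(a/n)\<close> are multiplicative and depend only on \<open>a\<close> modulo \<open>n\<close>, and every residue class
  prime to \<open>n\<close> contains odd positive integers, so they agree; reciprocity and the supplementary
  laws identify \<open>(a/n)\<close> with \<open>(n\<^sup>*/a)\<close>. If \<open>n\<close> is not a square, some prime \<open>p\<close> divides it to an
  odd power, and a nonresidue modulo \<open>p\<close> that is \<open>1\<close> modulo the other prime powers has Jacobi symbol
  \<open>-1\<close>.
\<close>

text \<open>Below, \<open>order\<close> is the order of a group, not the multiplicity of a root of a polynomial.\<close>

hide_const (open) Polynomial.order

section \<open>Jacobi symbols and the Kronecker symbol of \<open>n\<^sup>*\<close>\<close>

lemma Legendre_cong:
  assumes "[a = b] (mod p)"
  shows "Legendre a p = Legendre b p"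
  using assms by (simp add: Legendre_def QuadRes_def cong_def)

lemma Legendre_values: "Legendre a p \<in> {-1, 0, 1}"
  by (simp add: Legendre_def)

lemma cong_imp_eq_small:
  fixes x y p :: int
  assumes "[x = y] (mod p)" "x \<in> {-1, 0, 1}" "y \<in> {-1, 0, 1}" "2 < p"
  shows "x = y"
proof -
  have "p dvd x - y" using assms(1) by (simp add: cong_iff_dvd_diff)
  moreover have "\<bar>x - y\<bar> \<le> 2" using assms(2,3) by auto
  ultimately show ?thesis using assms(4) dvd_imp_le_int[of "x - y" p] by fastforce
qed

lemma Legendre_mult:
  fixes p :: nat
  assumes "prime p" "2 < p"
  shows "Legendre (a * b) p = Legendre a p * Legendre b p"
proof (rule cong_imp_eq_small[of _ _ "int p"])
  have "[Legendre (a * b) p = a ^ ((p - 1) div 2) * b ^ ((p - 1) div 2)] (mod p)"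
    using euler_criterion[OF assms, of "a * b"] by (simp add: power_mult_distrib)
  moreover have "[Legendre a p * Legendre b p = a ^ ((p - 1) div 2) * b ^ ((p - 1) div 2)] (mod p)"
    by (intro cong_mult euler_criterion assms)
  ultimately show "[Legendre (a * b) p = Legendre a p * Legendre b p] (mod int p)"
    using cong_trans cong_sym by blast
qed (use Legendre_values[of a p] Legendre_values[of b p] Legendre_values[of "a * b" p] assms(2) in auto)

lemma Legendre_one [simp]: "2 < p \<Longrightarrow> Legendre 1 p = 1"
  by (auto simp: Legendre_def QuadRes_def cong_def intro!: exI[of _ 1])

lemma Legendre_minus_one:
  fixes p :: nat
  assumes "prime p" "2 < p"
  shows "Legendre (-1) p = (-1) ^ ((p - 1) div 2)"
proof (rule cong_imp_eq_small[of _ _ "int p"])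
  show "[Legendre (-1) p = (-1) ^ ((p - 1) div 2)] (mod int p)"
    by (rule euler_criterion[OF assms])
qed (use Legendre_values[of _ p] assms(2) in \<open>auto simp: minus_one_power_iff\<close>)

lemma Legendre_square:
  fixes p :: nat
  assumes "prime p" "2 < p" "\<not> int p dvd a"
  shows "Legendre a p * Legendre a p = 1"
  using assms Legendre_values[of a p] by (auto simp: Legendre_def cong_0_iff)

text \<open>
  Second supplement, by Gauss's lemma: \<open>2, 4, \<dots>, p - 1\<close> are already reduced modulo \<open>p\<close>, so the
  sign changes are counted by the even numbers above \<open>p / 2\<close>.
\<close>

lemma Legendre_two:
  fixes p :: nat
  assumes "prime p" "2 < p"
  shows "Legendre 2 p = (if p mod 8 \<in> {1, 7} then 1 else -1)"
proof -
  have odd: "odd p" using assms prime_odd_nat by blast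
  interpret GAUSS p 2
    using assms by unfold_locales (auto simp: cong_0_iff dest: zdvd_imp_le)
  define h where "h = (int p - 1) div 2"
  have h: "int p = 2 * h + 1" using odd by (auto simp: h_def elim!: oddE)
  have "E = (\<lambda>x. 2 * x) ` {h div 2 <.. h}"
  proof -
    have "x * 2 mod int p = 2 * x" if "0 < x" "x \<le> h" for x
      using that h by (subst mod_pos_pos_trivial) auto
    then have C: "C = (\<lambda>x. 2 * x) ` {0 <.. h}"
      unfolding C_def B_def A_def h_def[symmetric] image_image by (intro image_cong) auto
    show ?thesis unfolding E_def C h_def[symmetric] using h by (auto simp: image_iff)
  qed
  then have "card E = nat (h - h div 2)"
    by (simp add: card_image inj_on_def)
  moreover have "h - h div 2 \<ge> 0" using h assms by linarith
  moreover have "even (h - h div 2) \<longleftrightarrow> p mod 8 \<in> {1, 7}"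
  proof -
    have "even (h - h div 2) \<longleftrightarrow> h mod 4 = 0 \<or> h mod 4 = 3" by presburger
    also have "\<dots> \<longleftrightarrow> int p mod 8 = 1 \<or> int p mod 8 = 7"
    proof -
      have "h = 4 * (h div 4) + h mod 4" by simp
      then have "int p = (2 * (h mod 4) + 1) + 8 * (h div 4)" using h by linarith
      then have "int p mod 8 = (2 * (h mod 4) + 1) mod 8" by (metis mod_mult_self2)
      also have "\<dots> = 2 * (h mod 4) + 1" by (rule mod_pos_pos_trivial) auto
      finally show ?thesis by auto
    qed
    also have "\<dots> \<longleftrightarrow> p mod 8 \<in> {1, 7}"
    proof -
      have "int p mod 8 = int (p mod 8)" by (simp add: zmod_int)
      then show ?thesis by auto
    qed
    finally show ?thesis .
  qed
  ultimately show ?thesis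
    using gauss_lemma by (auto simp: minus_one_power_iff even_nat_iff)
qed

definition jacobi :: "nat \<Rightarrow> int \<Rightarrow> int" where
  "jacobi n a = (\<Prod>p\<in>#prime_factorization n. Legendre a (int p))"

lemma jacobi_1 [simp]: "jacobi (Suc 0) a = 1"
  by (simp add: jacobi_def)

lemma jacobi_prime_mult: "prime p \<Longrightarrow> m > 0 \<Longrightarrow> jacobi (p * m) a = Legendre a p * jacobi m a"
  by (simp add: jacobi_def prime_factorization_mult prime_factorization_prime)

text \<open>
  This form of induction makes every multiplicative identity in an odd \<open>n\<close> a statement about
  odd primes.
\<close>

lemma odd_induct [consumes 1, case_names one prime]:
  fixes n :: nat
  assumes "odd n" "P 1"
    "\<And>p m. prime p \<Longrightarrow> 2 < p \<Longrightarrow> odd m \<Longrightarrow> P m \<Longrightarrow> P (p * m)"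
  shows "P n"
  using assms(1)
proof (induction n rule: less_induct)
  case (less n)
  show ?case
  proof (cases "n = 1")
    case False
    then obtain p where p: "prime p" "p dvd n" using prime_factor_nat by blast
    then obtain m where m: "n = p * m" by blast
    have "2 < p" using p less.prems m prime_gt_1_nat[of p] by (cases "p = 2") auto
    moreover have "m < n" using odd_pos[OF less.prems] m \<open>2 < p\<close> by simp
    moreover have "odd m" using less.prems m by simp
    ultimately show ?thesis using less.IH[of m] p m assms(3)[of p m] by simp
  qed (use assms in simp)
qed

lemma jacobi_cong:
  assumes "[a = b] (mod int n)"
  shows "jacobi n a = jacobi n b"
proof -
  have "Legendre a (int p) = Legendre b (int p)" if "p \<in># prime_factorization n" for p
    using that assms by (intro Legendre_cong) (auto intro: cong_dvd_modulus dest!: in_prime_factors_imp_dvd)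
  then show ?thesis
    unfolding jacobi_def by (intro arg_cong[where f = prod_mset] image_mset_cong) auto
qed

lemma jacobi_mult: "odd n \<Longrightarrow> jacobi n (a * b) = jacobi n a * jacobi n b"
  by (induction n rule: odd_induct) (auto simp: jacobi_prime_mult Legendre_mult odd_pos)

lemma jacobi_one: "odd n \<Longrightarrow> jacobi n 1 = 1"
  by (induction n rule: odd_induct) (auto simp: jacobi_prime_mult odd_pos)

lemma jacobi_square: "odd n \<Longrightarrow> coprime a (int n) \<Longrightarrow> jacobi n a * jacobi n a = 1"
proof (induction n rule: odd_induct)
  case (prime p m)
  have "Legendre a p * Legendre a p = 1"
    using prime by (intro Legendre_square) (auto simp: prime_imp_coprime_int coprime_commute 
      dest: coprime_common_divisor_int)
  moreover have "jacobi m a * jacobi m a = 1" using prime by auto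
  ultimately show ?case using prime
    by (simp add: jacobi_prime_mult odd_pos) (metis mult.assoc mult.left_commute mult.right_neutral)
qed simp

lemma n_star_mult: "odd m \<Longrightarrow> odd n \<Longrightarrow> n_star (m * n) = n_star m * n_star n"
proof -
  assume "odd m" "odd n"
  then obtain i j where "m = 2 * i + 1" "n = 2 * j + 1" by (metis oddE)
  moreover have "((2 * i + 1) * (2 * j + 1) - 1) div 2 = i + j + 2 * (i * j)" by (simp add: algebra_simps)
  ultimately show ?thesis by (simp add: n_star_def power_add algebra_simps)
qed

lemma n_star_1 [simp]: "n_star (Suc 0) = 1"
  by (simp add: n_star_def)

text \<open>
  Quadratic reciprocity for a composite denominator: the sign in \<open>p\<^sup>*\<close> is the one that turns the
  reciprocity law into \<open>(p\<^sup>*/q) = (q/p)\<close>, and \<open>n\<^sup>*\<close> is multiplicative in \<open>n\<close>.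
\<close>

lemma Legendre_n_star:
  fixes q :: nat
  assumes "prime q" "2 < q" "odd n" "\<not> q dvd n"
  shows "Legendre (n_star n) q = jacobi n q"
  using assms(3,4)
proof (induction n rule: odd_induct)
  case one
  then show ?case using assms by simp
next
  case (prime p m)
  have "p \<noteq> q" using prime.prems by auto
  define i j where "i = (p - 1) div 2" and "j = (q - 1) div 2"
  have "Legendre ((-1) ^ i) q = (-1) ^ (i * j)" for i
  proof (induction i)
    case (Suc i)
    then show ?case
      using assms Legendre_mult[OF assms(1,2), of "-1" "(-1) ^ i"]
      by (simp add: Legendre_minus_one j_def power_add)
  qed (use assms in simp)
  then have "Legendre (n_star p) q = (-1) ^ (i * j) * Legendre p q"
    by (simp add: n_star_def Legendre_mult assms i_def)
  also have "\<dots> = Legendre q p"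
  proof -
    have "Legendre p q * Legendre q p = (-1) ^ (i * j)"
      unfolding i_def j_def using prime assms \<open>p \<noteq> q\<close> by (intro Quadratic_Reciprocity) auto
    moreover have "Legendre p q * Legendre p q = 1"
      using assms prime \<open>p \<noteq> q\<close> primes_dvd_imp_eq[of q p] by (intro Legendre_square) auto
    ultimately show ?thesis by (metis mult.assoc mult.commute mult_1)
  qed
  finally have "Legendre (n_star p) q = Legendre q p" .
  moreover have "\<not> q dvd m" using prime.prems by auto
  ultimately show ?case
    using prime assms by (simp add: n_star_mult prime_odd_nat Legendre_mult jacobi_prime_mult odd_pos)
qed

lemma odd_mod_8:
  fixes n :: nat
  assumes "odd n"
  shows "n mod 8 \<in> {1, 3, 5, 7}"
proof -
  have "odd (n mod 8)" using assms by (simp add: dvd_mod_iff)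
  moreover have "x \<in> {1, 3, 5, 7}" if "odd x" "x < 8" for x :: nat
  proof -
    have "x = 0 \<or> x = 1 \<or> x = 2 \<or> x = 3 \<or> x = 4 \<or> x = 5 \<or> x = 6 \<or> x = 7"
      using that(2) by linarith
    then show ?thesis using that(1) by (elim disjE) simp_all
  qed
  ultimately show ?thesis by simp
qed

lemma kronecker_n_star_two: "odd n \<Longrightarrow> kronecker_prime (n_star n) 2 = jacobi n 2"
proof -
  have *: "kronecker_prime (n_star n) 2 = (if n mod 8 \<in> {1, 7} then 1 else -1)" if "odd n" for n
  proof -
    have "even ((n - 1) div 2) \<longleftrightarrow> n mod 4 = 1" using that by presburger
    then have star: "n_star n = (if n mod 4 = 1 then int n else - int n)"
      by (simp add: n_star_def minus_one_power_iff)
    have "int n mod 8 = int (n mod 8)" by (simp add: zmod_int)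
    moreover have "n mod 4 = n mod 8 mod 4" by (simp add: mod_mod_cancel)
    ultimately have "n_star n mod 8 = 1 \<longleftrightarrow> n mod 8 \<in> {1, 7}"
      using odd_mod_8[OF that] by (auto simp: star zmod_zminus1_eq_if)
    then show ?thesis using that by (simp add: kronecker_prime_def n_star_def)
  qed
  have "(if n mod 8 \<in> {1, 7} then 1 else -1) = jacobi n 2" if "odd n"
    using that
  proof (induction n rule: odd_induct)
    case (prime p m)
    have "p mod 8 \<in> {1, 3, 5, 7}" "m mod 8 \<in> {1, 3, 5, 7}"
      using odd_mod_8 prime prime_odd_nat[of p] by blast+
    then have "(if p * m mod 8 \<in> {1, 7} then 1 else -1 :: int) =
        (if p mod 8 \<in> {1, 7} then 1 else -1) * (if m mod 8 \<in> {1, 7} then 1 else -1)"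
      by (subst mod_mult_eq[symmetric]) auto
    then show ?case using prime by (simp add: jacobi_prime_mult Legendre_two odd_pos)
  qed simp
  with * show "odd n \<Longrightarrow> ?thesis" by simp
qed

lemma sgn_n_star: "odd n \<Longrightarrow> sgn (n_star n) = jacobi n (-1)"
proof (induction n rule: odd_induct)
  case (prime p m)
  then have "sgn (n_star p) = Legendre (-1) p"
    by (simp add: n_star_def Legendre_minus_one minus_one_power_iff)
  then show ?case
    using prime by (simp add: n_star_mult prime_odd_nat sgn_mult jacobi_prime_mult odd_pos)
qed simp

lemma kronecker_n_star:
  assumes "odd n" "coprime a (int n)" "a \<noteq> 0"
  shows "kronecker (n_star n) a = jacobi n a"
proof -
  have prime: "kronecker_prime (n_star n) p = jacobi n p" if p: "p \<in># prime_factorization a" for p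
  proof (cases "p = 2")
    case True
    then show ?thesis using assms kronecker_n_star_two by simp
  next
    case False
    have "prime p" using p by auto
    then obtain q where q: "p = int q" "prime q" using prime_int_nat_transfer prime_ge_0_int
      by (metis int_nat_eq)
    have "2 < q" using False q prime_ge_2_nat[of q] by auto
    moreover have "\<not> q dvd n" using assms p q
      by (metis coprime_common_divisor in_prime_factors_imp_dvd int_dvd_int_iff not_prime_unit
          \<open>prime p\<close>)
    ultimately show ?thesis using False q Legendre_n_star[of q n] assms by (simp add: kronecker_prime_def)
  qed
  have "kronecker (n_star n) a = (if a < 0 then jacobi n (-1) else 1) *
      (\<Prod>p\<in>#prime_factorization a. jacobi n p)"
    using assms prime by (simp add: kronecker_def sgn_n_star cong: image_mset_cong)
  also have "(\<Prod>p\<in>#A. jacobi n p) = jacobi n (prod_mset A)" for A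
    using assms by (induction A) (simp_all add: jacobi_one jacobi_mult)
  also have "prod_mset (prime_factorization a) = \<bar>a\<bar>"
    using assms by (simp add: prod_mset_prime_factorization)
  finally show ?thesis
    using assms by (auto simp: jacobi_mult[symmetric])
qed

lemma kronecker_n_star_not_coprime:
  assumes "odd n" "\<not> coprime a (int n)"
  shows "kronecker (n_star n) a = 0"
proof (cases "a = 0")
  case True
  have "n \<noteq> 1" using assms by auto
  then have "n_star n \<noteq> 1" by (auto simp: n_star_def minus_one_power_iff)
  then show ?thesis using True by (simp add: kronecker_def)
next
  case False
  obtain p where p: "prime p" "p dvd a" "p dvd int n"
    using assms(2) False prime_divisor_exists[of "gcd a (int n)"] by auto
  have "p \<noteq> 2" using p assms by auto
  then have "kronecker_prime (n_star n) p = 0"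
    using p by (simp add: kronecker_prime_def Legendre_def cong_0_iff n_star_def)
  moreover have "p \<in># prime_factorization a" using p False by (simp add: in_prime_factors_iff)
  ultimately have "0 \<in># image_mset (kronecker_prime (n_star n)) (prime_factorization a)"
    by force
  then show ?thesis using False by (simp add: kronecker_def)
qed

text \<open>
  Adding a multiple of \<open>n\<close> makes \<open>a\<close> odd and positive, hence a product of odd primes; in this way
  the values at \<open>2\<close> and \<open>-1\<close> are determined by those at odd primes.
\<close>

lemma periodic_character_eq_jacobi:
  fixes \<chi> :: "int \<Rightarrow> int"
  assumes "odd n"
    and one: "\<chi> 1 = 1"
    and mult: "\<And>a b. coprime a (int n) \<Longrightarrow> coprime b (int n) \<Longrightarrow> \<chi> (a * b) = \<chi> a * \<chi> b"
    and periodic: "\<And>a b. [a = b] (mod int n) \<Longrightarrow> \<chi> a = \<chi> b"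
    and prime: "\<And>q. prime q \<Longrightarrow> 2 < q \<Longrightarrow> \<not> q dvd n \<Longrightarrow> \<chi> (int q) = Legendre (n_star n) (int q)"
    and "coprime a (int n)"
  shows "\<chi> a = jacobi n a"
proof -
  have odd: "coprime b n \<Longrightarrow> \<chi> (int b) = jacobi n b" if "odd b" for b
    using that
  proof (induction b rule: odd_induct)
    case one
    then show ?case using assms by (simp add: jacobi_one)
  next
    case (prime q m)
    then have "\<not> q dvd n"
      by (metis coprime_common_divisor_nat dvd_triv_left not_prime_1)
    moreover have "coprime q n" "coprime m n" using prime by auto
    ultimately show ?case
      using prime assms by (simp add: mult jacobi_mult Legendre_n_star)
  qed
  define c where "c = (if even a then a + n else a) + 2 * \<bar>a\<bar> * int n"
  have "\<bar>a\<bar> * 1 \<le> \<bar>a\<bar> * int n" using assms(1) by (intro mult_left_mono) (auto elim: oddE)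
  then have "c \<ge> 0" by (auto simp: c_def)
  moreover have "odd c" using assms(1) by (auto simp: c_def)
  moreover have ca: "[c = a] (mod int n)" by (auto simp: c_def cong_iff_dvd_diff)
  moreover have "coprime c (int n)" using ca assms(6) by (metis cong_imp_coprime cong_sym)
  ultimately have "\<chi> c = jacobi n c" 
    using odd[of "nat c"] coprime_int_iff[of "nat c" n] by (simp add: even_nat_iff)
  then show ?thesis using ca periodic[OF ca] jacobi_cong[OF ca] by simp
qed

text \<open>
  Squaring identifies \<open>1\<close> and \<open>-1\<close>, so on the finite set of residues it is not onto.
\<close>

lemma nonresidue_exists:
  fixes p :: nat
  assumes "prime p" "2 < p"
  obtains g where "Legendre g p = -1"
proof -
  let ?f = "\<lambda>x. x\<^sup>2 mod int p"
  have "\<not> inj_on ?f {0..<int p}"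
  proof
    assume "inj_on ?f {0..<int p}"
    moreover have "?f 1 = ?f (int p - 1)"
    proof -
      have "int p dvd (int p - 1)\<^sup>2 - 1\<^sup>2" by (simp add: power2_eq_square algebra_simps)
      then show ?thesis by (metis mod_eq_dvd_iff)
    qed
    ultimately have "1 = int p - 1" using assms by (elim inj_onD) auto
    then show False using assms by simp
  qed
  moreover have "?f ` {0..<int p} \<subseteq> {0..<int p}" using assms by auto
  ultimately have "?f ` {0..<int p} \<noteq> {0..<int p}"
    using eq_card_imp_inj_on[of "{0..<int p}" ?f] by auto
  then obtain g where g: "g \<in> {0..<int p}" "g \<notin> ?f ` {0..<int p}"
    using \<open>?f ` _ \<subseteq> _\<close> by blast
  have "\<not> QuadRes p g"
  proof
    assume "QuadRes p g"
    then obtain y where "[y\<^sup>2 = g] (mod p)" by (auto simp: QuadRes_def)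
    then have "?f (y mod p) = g" using g by (simp add: cong_def power_mod)
    then show False using g assms by (metis atLeastLessThan_iff imageI of_nat_0_less_iff
       pos_mod_bound pos_mod_sign prime_gt_0_nat)
  qed
  moreover from this have "\<not> [g = 0] (mod p)"
    unfolding QuadRes_def by (metis cong_sym zero_power2)
  ultimately show ?thesis using that[of g] by (simp add: Legendre_def)
qed

lemma square_if_even_multiplicities:
  fixes n :: nat
  assumes "n > 0" "\<And>p. prime p \<Longrightarrow> even (multiplicity p n)"
  shows "\<exists>k. n = k\<^sup>2"
proof -
  have "n = (\<Prod>p\<in>prime_factors n. p ^ multiplicity p n)"
    using assms(1) by (simp add: prime_factorization_nat)
  also have "\<dots> = (\<Prod>p\<in>prime_factors n. (p ^ (multiplicity p n div 2))\<^sup>2)"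
  proof (intro prod.cong refl)
    fix p assume "p \<in> prime_factors n"
    then have "even (multiplicity p n)" using assms(2) by auto
    then show "p ^ multiplicity p n = (p ^ (multiplicity p n div 2))\<^sup>2" by (simp flip: power_mult)
  qed
  finally show ?thesis by (metis prod_power_distrib)
qed

text \<open>
  For the direction from left to right, a prime \<open>p\<close> of odd multiplicity in a nonsquare \<open>n\<close> and the
  Chinese remainder theorem yield an \<open>a\<close> that is a nonresidue modulo \<open>p\<close> and \<open>1\<close> modulo the part of
  \<open>n\<close> prime to \<open>p\<close>.
\<close>

lemma jacobi_trivial_iff:
  assumes "odd n"
  shows "(\<forall>a. coprime a (int n) \<longrightarrow> jacobi n a = 1) \<longleftrightarrow> (\<exists>k. n = k\<^sup>2)"
proof
  assume "\<exists>k. n = k\<^sup>2"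
  then obtain k where k: "n = k * k" by (auto simp: power2_eq_square)
  then have "odd k" using assms by auto
  moreover have "jacobi n a = jacobi k a * jacobi k a" for a
    using k odd_pos[OF \<open>odd k\<close>] by (simp add: jacobi_def prime_factorization_mult)
  ultimately show "\<forall>a. coprime a (int n) \<longrightarrow> jacobi n a = 1"
    using jacobi_square k by auto
next
  assume triv: "\<forall>a. coprime a (int n) \<longrightarrow> jacobi n a = 1"
  show "\<exists>k. n = k\<^sup>2"
  proof (rule ccontr)
    assume "\<nexists>k. n = k\<^sup>2"
    then obtain p where p: "prime p" "odd (multiplicity p n)"
      using square_if_even_multiplicities[of n] assms by (auto simp: odd_pos)
    define v where "v = multiplicity p n"
    obtain m where m: "n = p ^ v * m" "\<not> p dvd m"
      using multiplicity_decompose'[of n p] p assms unfolding v_def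
      by (metis not_prime_unit odd_pos less_irrefl)
    have "v > 0" using p by (auto simp: v_def odd_pos)
    then have "odd p" using m assms by auto
    then have "2 < p" using p prime_gt_1_nat[of p] by (cases "p = 2") auto
    obtain g where g: "Legendre g p = -1" using nonresidue_exists[OF p(1) \<open>2 < p\<close>] .
    have "coprime (int p) (int m)" using m p by (simp add: prime_imp_coprime_nat)
    then obtain a where a: "[a = g] (mod int p)" "[a = 1] (mod int m)"
      using binary_chinese_remainder_int by blast
    have "Legendre a p = -1" using g Legendre_cong[OF a(1)] by simp
    then have "\<not> int p dvd a" by (auto simp: Legendre_def cong_0_iff split: if_splits)
    then have "coprime a (int p)"
      using p(1) by (metis coprime_commute prime_imp_coprime prime_nat_int_transfer)
    moreover have "coprime a (int m)" using a(2) by (metis cong_imp_coprime cong_sym coprime_1_left)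
    ultimately have "coprime a (int n)" using m(1) by simp
    moreover have "jacobi (p ^ v * m) a = Legendre a p ^ v * jacobi m a" for v
    proof (induction v)
      case (Suc v)
      have "m > 0" using m by (intro Nat.gr0I) auto
      then show ?case using Suc p jacobi_prime_mult[of p "p ^ v * m" a] prime_gt_0_nat[of p]
        by (simp add: mult.assoc)
    qed simp
    moreover have "jacobi m a = 1"
      using jacobi_cong[OF a(2)] jacobi_one[of m] m assms by auto
    ultimately have "(-1) ^ v = (1 :: int)"
      using triv m(1) \<open>Legendre a p = -1\<close> by auto
    then show False using p by (simp add: v_def)
  qed
qed

section \<open>Signs of permutations commuting with an involution\<close>

lemma half_system_exists:
  assumes "finite A" "\<And>a. a \<in> A \<Longrightarrow> \<tau> a \<in> A" "\<And>a. a \<in> A \<Longrightarrow> \<tau> (\<tau> a) = a" "\<And>a. a \<in> A \<Longrightarrow> \<tau> a \<noteq> a"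
  obtains H where "H \<inter> \<tau> ` H = {}" "H \<union> \<tau> ` H = A"
proof -
  have "\<exists>H. H \<inter> \<tau> ` H = {} \<and> H \<union> \<tau> ` H = A"
    using assms
  proof (induction A rule: finite_psubset_induct)
    case (psubset A)
    show ?case
    proof (cases "A = {}")
      case False
      then obtain a where a: "a \<in> A" by blast
      let ?B = "A - {a, \<tau> a}"
      have "?B \<subset> A" using a by blast
      moreover have "\<tau> b \<in> ?B" if "b \<in> ?B" for b
      proof -
        have "\<tau> (\<tau> b) = b" "\<tau> (\<tau> a) = a" using psubset.prems(2) that a by blast+
        moreover have "b \<noteq> a" "b \<noteq> \<tau> a" using that by blast+
        ultimately have "\<tau> b \<noteq> a" "\<tau> b \<noteq> \<tau> a" by metis+
        then show ?thesis using that psubset.prems(1) by auto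
      qed
      ultimately have "\<exists>H. H \<inter> \<tau> ` H = {} \<and> H \<union> \<tau> ` H = ?B"
        using psubset.prems(2,3) by (intro psubset.IH) simp_all
      then obtain H where H: "H \<inter> \<tau> ` H = {}" "H \<union> \<tau> ` H = ?B" by blast
      have "a \<notin> H \<union> \<tau> ` H" "\<tau> a \<notin> H \<union> \<tau> ` H" "\<tau> a \<noteq> a" "\<tau> a \<in> A"
        using H(2) a psubset.prems by auto
      then have "insert a H \<inter> \<tau> ` insert a H = {}" "insert a H \<union> \<tau> ` insert a H = A"
        using H a by auto
      then show ?thesis by blast
    qed auto
  qed
  then show ?thesis using that by blast
qed

lemma sign_involution_on:
  assumes "finite F" "F \<inter> \<tau> ` F = {}" "\<And>x. x \<in> F \<Longrightarrow> \<tau> (\<tau> x) = x"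
  shows "sign (\<lambda>x. if x \<in> F \<union> \<tau> ` F then \<tau> x else x) = (-1) ^ card F"
    and "(\<lambda>x. if x \<in> F \<union> \<tau> ` F then \<tau> x else x) permutes (F \<union> \<tau> ` F)"
proof -
  have "sign (\<lambda>x. if x \<in> F \<union> \<tau> ` F then \<tau> x else x) = (-1) ^ card F \<and>
    (\<lambda>x. if x \<in> F \<union> \<tau> ` F then \<tau> x else x) permutes (F \<union> \<tau> ` F)"
    using assms
  proof (induction F)
    case empty
    then show ?case by (simp add: permutes_def)
  next
    case (insert a F)
    let ?s = "\<lambda>F x. if x \<in> F \<union> \<tau> ` F then \<tau> x else x"
    have IH: "sign (?s F) = (-1) ^ card F" "?s F permutes (F \<union> \<tau> ` F)"
      using insert by auto
    have fin: "finite (F \<union> \<tau> ` F)" using insert by auto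
    have a: "a \<noteq> \<tau> a" "\<tau> (\<tau> a) = a" "a \<notin> F \<union> \<tau> ` F" "\<tau> a \<notin> F \<union> \<tau> ` F"
      using insert.prems insert.hyps by (auto, metis insertCI)
    have eq: "?s (insert a F) = transpose a (\<tau> a) \<circ> ?s F"
    proof
      fix x
      consider "x = a" | "x = \<tau> a" | "x \<in> F \<union> \<tau> ` F" | "x \<notin> insert a F \<union> \<tau> ` insert a F" by blast
      then show "?s (insert a F) x = (transpose a (\<tau> a) \<circ> ?s F) x"
      proof cases
        case 3
        then have "\<tau> x \<in> F \<union> \<tau> ` F" using permutes_in_image[OF IH(2), of x] by simp
        then have "\<tau> x \<noteq> a" "\<tau> x \<noteq> \<tau> a" using a by metis+
        then show ?thesis using 3 by (auto simp: transpose_def)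
      qed (use a in \<open>auto simp: transpose_def\<close>)
    qed
    have perm: "permutation (?s F)" using IH(2) fin by (rule permutes_imp_permutation[rotated])
    have "sign (?s (insert a F)) = - sign (?s F)"
      unfolding eq using a perm
      by (subst sign_compose) (auto simp: sign_swap_id permutation_swap_id)
    moreover have "?s (insert a F) permutes (insert a F \<union> \<tau> ` insert a F)"
      unfolding eq by (intro permutes_compose permutes_subset[OF IH(2)] permutes_swap_id) auto
    ultimately show ?case using IH insert.hyps by simp
  qed
  then show "sign (\<lambda>x. if x \<in> F \<union> \<tau> ` F then \<tau> x else x) = (-1) ^ card F"
    and "(\<lambda>x. if x \<in> F \<union> \<tau> ` F then \<tau> x else x) permutes (F \<union> \<tau> ` F)" by auto
qed

text \<open>
  The argument of Gauss's lemma. Composing \<open>p\<close> with the swaps \<open>h \<leftrightarrow> \<tau> h\<close> for those \<open>h\<close> that \<open>p\<close> moves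
  out of \<open>H\<close> gives a permutation that preserves \<open>H\<close> and acts on \<open>\<tau> H\<close> by the conjugate action; it is
  even, so only the swaps count.
\<close>

lemma sign_commuting_involution:
  assumes fin: "finite H" and disj: "H \<inter> \<tau> ` H = {}"
    and inv: "\<And>x. x \<in> H \<Longrightarrow> \<tau> (\<tau> x) = x"
    and p: "p permutes (H \<union> \<tau> ` H)"
    and comm: "\<And>x. x \<in> H \<union> \<tau> ` H \<Longrightarrow> p (\<tau> x) = \<tau> (p x)"
  shows "sign p = (\<Prod>h\<in>H. if p h \<in> H then 1 else -1)"
proof -
  let ?A = "H \<union> \<tau> ` H"
  define F where "F = {h \<in> H. p h \<notin> H}"
  define s where "s = (\<lambda>x. if x \<in> F \<union> \<tau> ` F then \<tau> x else x)"
  \<comment> \<open>The function \<open>\<tau>\<close> may be arbitrary outside \<open>H\<close> and its image; \<open>t\<close> is the permutation it induces.\<close>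
  define t where "t = (\<lambda>x. if x \<in> ?A then \<tau> x else x)"
  have F: "finite F" "F \<inter> \<tau> ` F = {}" "\<And>x. x \<in> F \<Longrightarrow> \<tau> (\<tau> x) = x"
    using fin disj inv by (auto simp: F_def)
  have s: "sign s = (-1) ^ card F" "s permutes (F \<union> \<tau> ` F)"
    unfolding s_def using sign_involution_on[OF F] by auto
  have sA: "s permutes ?A" by (rule permutes_subset[OF s(2)]) (auto simp: F_def)
  have t: "t permutes ?A" unfolding t_def by (rule sign_involution_on(2)) (use fin disj inv in auto)
  have finA: "finite ?A" using fin by simp
  have tau_A: "\<tau> x \<in> ?A" "\<tau> (\<tau> x) = x" if "x \<in> ?A" for x using that inv by auto
  define r where "r = p \<circ> s"
  have r: "r permutes ?A" unfolding r_def by (rule permutes_compose[OF sA p])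
  have pA: "p x \<in> ?A \<longleftrightarrow> x \<in> ?A" for x using p by (rule permutes_in_image)
  have rH: "r h \<in> H" if "h \<in> H" for h
  proof (cases "h \<in> F")
    case True
    then have "p h \<in> \<tau> ` H" using pA[of h] by (auto simp: F_def)
    then have "\<tau> (p h) \<in> H" using inv by auto
    then show ?thesis using True comm[of h] that by (simp add: r_def s_def)
  next
    case False
    then have "h \<notin> F \<union> \<tau> ` F" using disj that by (auto simp: F_def)
    then show ?thesis using False that by (auto simp: r_def s_def F_def)
  qed
  have s_comm: "s (\<tau> x) = \<tau> (s x)" if "x \<in> ?A" for x
  proof -
    have "\<tau> x \<in> F \<union> \<tau> ` F \<longleftrightarrow> x \<in> F \<union> \<tau> ` F"
    proof
      assume "\<tau> x \<in> F \<union> \<tau> ` F"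
      then have "\<tau> (\<tau> x) \<in> F \<union> \<tau> ` F" using F(3) by auto
      then show "x \<in> F \<union> \<tau> ` F" using tau_A(2)[OF that] by simp
    next
      assume "x \<in> F \<union> \<tau> ` F"
      then show "\<tau> x \<in> F \<union> \<tau> ` F" using F(3) by auto
    qed
    then show ?thesis by (simp add: s_def)
  qed
  have r_comm: "r (\<tau> x) = \<tau> (r x)" if "x \<in> ?A" for x
    using that s_comm comm permutes_in_image[OF sA, of x] by (simp add: r_def)
  define r1 where "r1 = restrict_id r H"
  define r2 where "r2 = restrict_id r (\<tau> ` H)"
  have bij1: "bij_betw r H H"
    using rH fin permutes_inj_on[OF r] by (simp add: bij_betw_def endo_inj_surj image_subset_iff)
  then have p1: "r1 permutes H" unfolding r1_def by (rule permutes_restrict_id)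
  have rH': "r h \<in> \<tau> ` H" if "h \<in> \<tau> ` H" for h using that rH r_comm by auto
  then have "bij_betw r (\<tau> ` H) (\<tau> ` H)"
    using fin permutes_inj_on[OF r] by (simp add: bij_betw_def endo_inj_surj image_subset_iff)
  then have p2: "r2 permutes \<tau> ` H" unfolding r2_def by (rule permutes_restrict_id)
  have perm: "permutation r1" "permutation r2" "permutation t" "permutation p" "permutation s"
    using p1 p2 t p sA fin finA by (meson finite_imageI permutation_permutes)+
  have "r = r1 \<circ> r2"
  proof
    fix x
    consider "x \<in> H" | "x \<in> \<tau> ` H" | "x \<notin> ?A" by blast
    then show "r x = (r1 \<circ> r2) x"
      using rH' disj permutes_not_in[OF r, of x]
      by cases (auto simp: r1_def r2_def restrict_id_def)
  qed
  then have "sign r = sign r1 * sign r2" using perm by (simp add: sign_compose)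
  moreover have "r2 = t \<circ> r1 \<circ> t"
  proof
    fix x
    consider "x \<in> H" | "x \<in> \<tau> ` H" | "x \<notin> ?A" by blast
    then show "r2 x = (t \<circ> r1 \<circ> t) x"
    proof cases
      case 1
      then have "x \<notin> \<tau> ` H" "\<tau> x \<notin> H" using disj by auto
      then show ?thesis using 1 inv by (simp add: r1_def r2_def t_def restrict_id_def)
    next
      case 2
      then have "\<tau> x \<in> H" "\<tau> (\<tau> x) = x" using inv by auto
      moreover from this have "\<tau> (r (\<tau> x)) = r x" using r_comm[of "\<tau> x"] by auto
      ultimately show ?thesis using 2 rH by (simp add: r1_def r2_def t_def restrict_id_def)
    next
      case 3
      then show ?thesis by (simp add: r1_def r2_def t_def restrict_id_def)
    qed
  qed
  then have "sign r2 = sign r1"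
    using perm by (simp add: sign_compose permutation_compose mult.commute)
  moreover have "sign r = sign p * sign s" using perm by (simp add: r_def sign_compose)
  ultimately have "sign p * sign s = 1" by simp
  then have "sign p = sign s" by (metis sign_idempotent mult.right_neutral mult.assoc mult.commute)
  also have "\<dots> = (\<Prod>h\<in>F. -1)" using s by simp
  also have "\<dots> = (\<Prod>h\<in>H. if p h \<in> H then 1 else -1)"
    unfolding F_def prod.inter_filter[OF fin] by (intro prod.cong) auto
  finally show ?thesis .
qed

section \<open>Integer determinants modulo a prime\<close>

lemma fermat_int_prime:
  fixes a :: int and q :: nat
  assumes "prime q"
  shows "[a ^ q = a] (mod int q)"
proof -
  define c where "c = nat (a mod int q)"
  have q: "q > 0" using assms prime_gt_0_nat by blast
  have c: "[int c = a] (mod int q)" using q by (simp add: c_def)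
  have "[c ^ q = c] (mod q)"
  proof (cases "q dvd c")
    case True
    then have "q dvd c ^ q" using q by (meson dvd_power dvd_trans)
    then show ?thesis using True by (simp add: cong_def)
  next
    case False
    have "[c * c ^ (q - 1) = c * 1] (mod q)"
      using fermat_theorem[OF assms False] by (rule cong_scalar_left)
    then show ?thesis using q by (simp flip: power_Suc)
  qed
  then have "[int c ^ q = int c] (mod int q)" by (metis cong_int_iff of_nat_power)
  with c show ?thesis by (meson cong_pow cong_sym cong_trans)
qed

lemma det_cong_mod:
  fixes A B :: "int mat"
  assumes "A \<in> carrier_mat N N" "B \<in> carrier_mat N N"
    and "\<And>i j. i < N \<Longrightarrow> j < N \<Longrightarrow> [A $$ (i, j) = B $$ (i, j)] (mod q)"
  shows "[det A = det B] (mod q)"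
  unfolding det_def'[OF assms(1)] det_def'[OF assms(2)]
proof (intro cong_sum cong_mult cong_refl cong_prod)
  fix p i assume "p \<in> {p. p permutes {0..<N}}" "i \<in> {0..<N}"
  then have "p i < N" using permutes_in_image[of p "{0..<N}" i] by auto
  then show "[A $$ (i, p i) = B $$ (i, p i)] (mod q)" using assms(3) \<open>i \<in> _\<close> by auto
qed

lemma det_diag:
  fixes A :: "int mat"
  assumes "A \<in> carrier_mat N N" "\<And>i j. i < N \<Longrightarrow> j < N \<Longrightarrow> i \<noteq> j \<Longrightarrow> A $$ (i, j) = 0"
  shows "det A = (\<Prod>i<N. A $$ (i, i))"
proof -
  have "upper_triangular A" using assms by (auto simp: upper_triangular_def)
  then show ?thesis using assms(1)
    by (simp add: det_upper_triangular prod_list_diag_prod atLeast0LessThan)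
qed

lemma det_pow: "A \<in> carrier_mat N N \<Longrightarrow> det (A ^\<^sub>m k) = det A ^ k"
  by (induction k) (auto simp: det_mult[of _ N])

lemma index_mult_mat_sum:
  assumes "A \<in> carrier_mat N N" "B \<in> carrier_mat N N" "i < N" "j < N"
  shows "(A * B) $$ (i, j) = (\<Sum>k<N. A $$ (i, k) * B $$ (k, j))"
  using assms by (simp add: scalar_prod_def atLeast0LessThan)

text \<open>
  An injective linear endomorphism of the finite module \<open>(\<int>/q)\<^sup>N\<close> is surjective; preimages of
  the unit vectors form a right inverse.
\<close>

lemma coprime_det_if_injective:
  fixes A :: "int mat"
  assumes A: "A \<in> carrier_mat N N" and "q > 0"
    and inj: "\<And>v. (\<And>i. i < N \<Longrightarrow> [(\<Sum>j<N. A $$ (i, j) * v j) = 0] (mod q)) \<Longrightarrow>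
      (\<And>j. j < N \<Longrightarrow> [v j = 0] (mod q))"
  shows "coprime (det A) q"
proof -
  let ?V = "{..<N} \<rightarrow>\<^sub>E {0..<q}"
  define f where "f = (\<lambda>v. \<lambda>i\<in>{..<N}. (\<Sum>j<N. A $$ (i, j) * v j) mod q)"
  have into: "f ` ?V \<subseteq> ?V" using assms(2)
    by (intro image_subsetI) (simp add: f_def restrict_PiE_iff)
  have "inj_on f ?V"
  proof (rule inj_onI)
    fix v w assume v: "v \<in> ?V" and w: "w \<in> ?V" and eq: "f v = f w"
    have "[v j - w j = 0] (mod q)" if "j < N" for j
    proof (rule inj[of "\<lambda>j. v j - w j", OF _ that])
      fix i assume "i < N"
      then have "[(\<Sum>j<N. A $$ (i, j) * v j) = (\<Sum>j<N. A $$ (i, j) * w j)] (mod q)"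
        using fun_cong[OF eq, of i] by (simp add: f_def cong_def)
      then show "[(\<Sum>j<N. A $$ (i, j) * (v j - w j)) = 0] (mod q)"
        by (simp add: right_diff_distrib sum_subtractf cong_diff_iff_cong_0)
    qed
    then have "v j = w j" if "j < N" for j
      using that PiE_mem[OF v, of j] PiE_mem[OF w, of j] cong_less_imp_eq_int[of "v j" q "w j"]
      by (simp add: cong_diff_iff_cong_0)
    then show "v = w" using v w by (intro PiE_ext) auto
  qed
  moreover have "finite ?V" by (intro finite_PiE) auto
  ultimately have surj: "f ` ?V = ?V" using into endo_inj_surj by blast
  have "\<exists>v. \<forall>i<N. [(\<Sum>j<N. A $$ (i, j) * v j) = (if i = c then 1 else 0)] (mod q)" for c
  proof -
    have "(\<lambda>i\<in>{..<N}. (if i = c then 1 else 0) mod q) \<in> ?V" using assms(2) by (simp add: restrict_PiE_iff)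
    then obtain v where "f v = (\<lambda>i\<in>{..<N}. (if i = c then 1 else 0) mod q)"
      using surj by (metis imageE)
    then have fv: "f v i = (\<lambda>i\<in>{..<N}. (if i = c then 1 else 0) mod q) i" for i by simp
    have "[(\<Sum>j<N. A $$ (i, j) * v j) = (if i = c then 1 else 0)] (mod q)" if "i < N" for i
      using fv[of i] that by (simp add: f_def cong_def)
    then show ?thesis by blast
  qed
  then obtain V where V: "\<And>c i. i < N \<Longrightarrow> [(\<Sum>j<N. A $$ (i, j) * V c j) = (if i = c then 1 else 0)] (mod q)"
    by metis
  define B where "B = mat N N (\<lambda>(j, c). V c j)"
  have B: "B \<in> carrier_mat N N" by (simp add: B_def)
  have "[det (A * B) = det (1\<^sub>m N)] (mod q)"
  proof (rule det_cong_mod[of _ N])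
    fix i j assume ij: "i < N" "j < N"
    then have "(A * B) $$ (i, j) = (\<Sum>k<N. A $$ (i, k) * V j k)"
      using A B by (subst index_mult_mat_sum[of _ N]) (auto simp: B_def)
    then show "[(A * B) $$ (i, j) = 1\<^sub>m N $$ (i, j)] (mod q)" using V[of i j] ij by simp
  qed (use A B in auto)
  then have "[det A * det B = 1] (mod q)" using det_mult[OF A B] by simp
  then show ?thesis by (metis coprime_iff_invertible_int)
qed

text \<open>
  Taking determinants in the first relation leaves \<open>1 = det L\<^sup>k det S\<close>, since \<open>P\<close> and \<open>M\<close> are
  invertible modulo \<open>q\<close> and occur on both sides.
  The Gram relation shows that \<open>d\<close> times \<open>det L\<close> is the square of \<open>det M\<close>, and raising this to the power
  \<open>k = (q - 1)/2\<close> gives \<open>d\<^sup>k det L\<^sup>k = 1\<close> by Fermat.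
\<close>

lemma det_cong_if_twisted_similitude:
  fixes M L P S :: "int mat" and q :: nat
  assumes q: "prime q" "2 < q"
    and car: "M \<in> carrier_mat N N" "L \<in> carrier_mat N N" "P \<in> carrier_mat N N" "S \<in> carrier_mat N N"
      "K \<in> carrier_mat N N" "\<Gamma> \<in> carrier_mat N N"
    and frob: "\<And>i j. i < N \<Longrightarrow> j < N \<Longrightarrow>
      [(P * M) $$ (i, j) = (M * (L ^\<^sub>m ((q - 1) div 2) * (S * P))) $$ (i, j)] (mod int q)"
    and gram: "M\<^sup>T * K * M = \<Gamma> * L"
    and P: "P * P\<^sup>T = 1\<^sub>m N"
    and M: "coprime (det M) (int q)"
    and disc: "det \<Gamma> = d * det K" "coprime (det K) (int q)"
  shows "[det S = d ^ ((q - 1) div 2)] (mod int q)"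
proof -
  define k where "k = (q - 1) div 2"
  have "det P * det P = 1"
    using arg_cong[OF P, of det] car det_mult[of P N "P\<^sup>T"] det_transpose[of P N] by simp
  have "[det (P * M) = det (M * (L ^\<^sub>m k * (S * P)))] (mod int q)"
    using car frob by (intro det_cong_mod[of _ N]) (auto simp: k_def)
  then have "[det P * det M = det M * (det L ^ k * (det S * det P))] (mod int q)"
  proof -
    have "L ^\<^sub>m k \<in> carrier_mat N N" "S * P \<in> carrier_mat N N"
      "L ^\<^sub>m k * (S * P) \<in> carrier_mat N N"
      using car by auto
    then have "det (M * (L ^\<^sub>m k * (S * P))) = det M * (det L ^ k * (det S * det P))"
      using car by (simp only: det_mult[of _ N] det_pow[of _ N])
    moreover have "det (P * M) = det P * det M" using car by (simp only: det_mult[of _ N])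
    ultimately show ?thesis using \<open>[det (P * M) = _] (mod int q)\<close> by simp
  qed
  then have "[det M * det P = det M * (det L ^ k * det S * det P)] (mod int q)"
    by (simp add: mult_ac)
  then have "[det P = det L ^ k * det S * det P] (mod int q)"
    using M cong_mult_lcancel by blast
  from cong_scalar_right[OF this, of "det P"] \<open>det P * det P = 1\<close>
  have 1: "[1 = det L ^ k * det S] (mod int q)" by (simp add: mult.assoc)
  have "det M * det K * det M = det \<Gamma> * det L"
    using arg_cong[OF gram, of det] car det_transpose[of M N] by (simp add: det_mult[of _ N])
  then have "det K * (det M)\<^sup>2 = det K * (d * det L)"
    using disc by (simp add: power2_eq_square mult_ac)
  moreover have "det K \<noteq> 0" using disc(2) q by (auto simp: zdvd1_eq)
  ultimately have "(det M)\<^sup>2 = d * det L" by simp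
  have "2 * k = q - 1" using q prime_odd_nat[of q] by (auto simp: k_def)
  have "[det M ^ (q - 1) = 1] (mod int q)"
  proof -
    have "[det M * det M ^ (q - 1) = det M * 1] (mod int q)"
      using fermat_int_prime[OF q(1), of "det M"] q by (simp flip: power_Suc)
    then show ?thesis using M cong_mult_lcancel by blast
  qed
  then have "[d ^ k * det L ^ k = 1] (mod int q)"
    using \<open>(det M)\<^sup>2 = d * det L\<close> \<open>2 * k = q - 1\<close> by (metis power_mult power_mult_distrib)
  from cong_scalar_right[OF this, of "det S"] cong_scalar_left[OF 1, of "d ^ k"]
  show ?thesis unfolding k_def[symmetric] by (metis cong_sym cong_trans mult.assoc mult_1 mult.right_neutral)
qed

section \<open>Convolution of integer functions on a finite group\<close>

locale finite_grp = group G for G (structure) +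
  assumes fin [simp, intro]: "finite (carrier G)"
begin

text \<open>
  Convolutions and class functions vanish off the carrier, so that the ring identities below are
  equalities of functions and can be used for rewriting.
\<close>

definition conv :: "('a \<Rightarrow> int) \<Rightarrow> ('a \<Rightarrow> int) \<Rightarrow> 'a \<Rightarrow> int" where
  "conv f g = (\<lambda>x. if x \<in> carrier G then \<Sum>y\<in>carrier G. f y * g (inv y \<otimes> x) else 0)"

definition delta :: "'a \<Rightarrow> int" where
  "delta = (\<lambda>x. if x = \<one> then 1 else 0)"

definition cpow :: "('a \<Rightarrow> int) \<Rightarrow> nat \<Rightarrow> 'a \<Rightarrow> int" where
  "cpow f k = (conv f ^^ k) delta"

definition class_fun :: "('a \<Rightarrow> int) \<Rightarrow> bool" where
  "class_fun f \<longleftrightarrow> (\<forall>x. x \<notin> carrier G \<longrightarrow> f x = 0) \<and>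
     (\<forall>g\<in>carrier G. \<forall>x\<in>carrier G. f (g \<otimes> x \<otimes> inv g) = f x)"

definition all_one :: "'a \<Rightarrow> int" where
  "all_one = (\<lambda>x. if x \<in> carrier G then 1 else 0)"

text \<open>
  The augmentation of the group ring.
\<close>

definition mass :: "('a \<Rightarrow> int) \<Rightarrow> int" where
  "mass f = (\<Sum>y\<in>carrier G. f y)"

lemma cpow_0 [simp]: "cpow f 0 = delta"
  by (simp add: cpow_def)

lemma cpow_Suc [simp]: "cpow f (Suc k) = conv f (cpow f k)"
  by (simp add: cpow_def)

lemma conv_outside [simp]: "x \<notin> carrier G \<Longrightarrow> conv f g x = 0"
  by (simp add: conv_def)

lemma sum_left_translate:
  assumes "a \<in> carrier G"
  shows "(\<Sum>y\<in>carrier G. (f (a \<otimes> y) :: int)) = (\<Sum>y\<in>carrier G. f y)"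
  by (rule sum.reindex_bij_witness[where i = "\<lambda>y. inv a \<otimes> y" and j = "\<lambda>y. a \<otimes> y"])
     (use assms in \<open>auto simp: m_assoc[symmetric]\<close>)

lemma sum_right_translate:
  assumes "a \<in> carrier G"
  shows "(\<Sum>y\<in>carrier G. (f (y \<otimes> a) :: int)) = (\<Sum>y\<in>carrier G. f y)"
  by (rule sum.reindex_bij_witness[where i = "\<lambda>y. y \<otimes> inv a" and j = "\<lambda>y. y \<otimes> a"])
     (use assms in \<open>auto simp: m_assoc\<close>)

lemma sum_inverse: "(\<Sum>y\<in>carrier G. (f (inv y) :: int)) = (\<Sum>y\<in>carrier G. f y)"
  by (rule sum.reindex_bij_witness[where i = "\<lambda>y. inv y" and j = "\<lambda>y. inv y"]) auto

lemma conv_flip: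
  assumes x: "x \<in> carrier G"
  shows "conv f g x = (\<Sum>y\<in>carrier G. f (x \<otimes> inv y) * g y)"
proof -
  have "conv f g x = (\<Sum>y\<in>carrier G. f (x \<otimes> y) * g (inv (x \<otimes> y) \<otimes> x))"
    using x sum_left_translate[OF x, of "\<lambda>y. f y * g (inv y \<otimes> x)"] by (simp add: conv_def)
  also have "\<dots> = (\<Sum>y\<in>carrier G. f (x \<otimes> y) * g (inv y))"
    using x by (intro sum.cong refl) (simp add: inv_mult_group m_assoc)
  also have "\<dots> = (\<Sum>y\<in>carrier G. f (x \<otimes> inv y) * g y)"
    using sum_inverse[of "\<lambda>y. f (x \<otimes> inv y) * g y"] by simp
  finally show ?thesis .
qed

lemma conv_assoc: "conv (conv f g) h = conv f (conv g h)"
proof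
  fix x
  show "conv (conv f g) h x = conv f (conv g h) x"
  proof (cases "x \<in> carrier G")
    case x: True
    have "conv (conv f g) h x =
        (\<Sum>y\<in>carrier G. \<Sum>z\<in>carrier G. f z * g (inv z \<otimes> y) * h (inv y \<otimes> x))"
      using x by (simp add: conv_def sum_distrib_right)
    also have "\<dots> = (\<Sum>z\<in>carrier G. \<Sum>y\<in>carrier G. f z * g (inv z \<otimes> y) * h (inv y \<otimes> x))"
      by (rule sum.swap)
    also have "\<dots> = (\<Sum>z\<in>carrier G. f z * conv g h (inv z \<otimes> x))"
    proof (intro sum.cong refl)
      fix z assume z: "z \<in> carrier G"
      have "(\<Sum>y\<in>carrier G. f z * g (inv z \<otimes> y) * h (inv y \<otimes> x)) =
          (\<Sum>y\<in>carrier G. f z * g (inv z \<otimes> (z \<otimes> y)) * h (inv (z \<otimes> y) \<otimes> x))"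
        using sum_left_translate[OF z, of "\<lambda>y. f z * g (inv z \<otimes> y) * h (inv y \<otimes> x)"] by simp
      also have "\<dots> = (\<Sum>y\<in>carrier G. f z * g y * h (inv y \<otimes> (inv z \<otimes> x)))"
        using x z by (intro sum.cong refl) (simp add: inv_mult_group m_assoc[symmetric])
      finally show "(\<Sum>y\<in>carrier G. f z * g (inv z \<otimes> y) * h (inv y \<otimes> x)) = f z * conv g h (inv z \<otimes> x)"
        using x z by (simp add: conv_def sum_distrib_left mult.assoc)
    qed
    finally show ?thesis using x by (simp add: conv_def)
  qed simp
qed

lemma class_fun_outside: "class_fun f \<Longrightarrow> x \<notin> carrier G \<Longrightarrow> f x = 0"
  by (simp add: class_fun_def)

lemma class_fun_conj:
  "class_fun f \<Longrightarrow> g \<in> carrier G \<Longrightarrow> x \<in> carrier G \<Longrightarrow> f (g \<otimes> x \<otimes> inv g) = f x"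
  by (simp add: class_fun_def)

lemma class_fun_commute:
  assumes "class_fun f" "x \<in> carrier G" "y \<in> carrier G"
  shows "f (x \<otimes> y) = f (y \<otimes> x)"
  using class_fun_conj[OF assms(1), of y "x \<otimes> y"] assms by (simp add: m_assoc)

lemma conv_commute:
  assumes "class_fun f"
  shows "conv f g = conv g f"
proof
  fix x
  show "conv f g x = conv g f x"
  proof (cases "x \<in> carrier G")
    case True
    then have "conv f g x = (\<Sum>y\<in>carrier G. f (inv y \<otimes> x) * g y)"
      unfolding conv_flip[OF True]
      using assms by (intro sum.cong refl) (simp add: class_fun_commute)
    then show ?thesis using True by (simp add: conv_def mult.commute)
  qed simp
qed

lemma conv_left_commute:
  assumes "class_fun f"
  shows "conv f (conv g h) = conv g (conv f h)"
  by (metis assms conv_assoc conv_commute)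

lemma class_fun_conv:
  assumes "class_fun f" "class_fun g"
  shows "class_fun (conv f g)"
proof -
  have "conv f g (h \<otimes> x \<otimes> inv h) = conv f g x" if h: "h \<in> carrier G" and x: "x \<in> carrier G" for h x
  proof -
    have "conv f g (h \<otimes> x \<otimes> inv h) = (\<Sum>y\<in>carrier G. f y * g (inv y \<otimes> (h \<otimes> x \<otimes> inv h)))"
      using h x by (simp add: conv_def)
    also have "\<dots> = (\<Sum>y\<in>carrier G. f (h \<otimes> y \<otimes> inv h) * g (inv (h \<otimes> y \<otimes> inv h) \<otimes> (h \<otimes> x \<otimes> inv h)))"
      using h sum_right_translate[of "inv h" "\<lambda>y. f (h \<otimes> y) * g (inv (h \<otimes> y) \<otimes> (h \<otimes> x \<otimes> inv h))"]
        sum_left_translate[of h "\<lambda>y. f y * g (inv y \<otimes> (h \<otimes> x \<otimes> inv h))"]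
      by (simp add: m_assoc)
    also have "\<dots> = (\<Sum>y\<in>carrier G. f y * g (h \<otimes> (inv y \<otimes> x) \<otimes> inv h))"
    proof (intro sum.cong refl)
      fix y assume y: "y \<in> carrier G"
      have "inv (h \<otimes> y \<otimes> inv h) \<otimes> (h \<otimes> x \<otimes> inv h) = h \<otimes> inv y \<otimes> (inv h \<otimes> h) \<otimes> x \<otimes> inv h"
        using h x y by (simp only: inv_mult_group m_closed inv_closed inv_inv m_assoc)
      also have "\<dots> = h \<otimes> (inv y \<otimes> x) \<otimes> inv h" using h x y by (simp add: m_assoc)
      finally show "f (h \<otimes> y \<otimes> inv h) * g (inv (h \<otimes> y \<otimes> inv h) \<otimes> (h \<otimes> x \<otimes> inv h)) =
          f y * g (h \<otimes> (inv y \<otimes> x) \<otimes> inv h)"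
        using assms(1) h y by (simp add: class_fun_conj)
    qed
    also have "\<dots> = conv f g x"
      using assms(2) h x by (simp add: conv_def class_fun_conj)
    finally show ?thesis .
  qed
  then show ?thesis by (simp add: class_fun_def)
qed

lemma class_fun_delta: "class_fun delta"
proof -
  have "g \<otimes> x \<otimes> inv g = \<one> \<longleftrightarrow> x = \<one>" if "g \<in> carrier G" "x \<in> carrier G" for g x
    using that by (metis inv_solve_right' l_one m_assoc r_cancel_one inv_closed m_closed one_closed r_one r_inv inv_inv)
  then show ?thesis by (auto simp: class_fun_def delta_def)
qed

lemma class_fun_cpow: "class_fun f \<Longrightarrow> class_fun (cpow f k)"
  by (induction k) (auto simp: class_fun_delta class_fun_conv)

lemma conv_delta_right: "class_fun f \<Longrightarrow> conv f delta = f"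
proof
  fix x assume f: "class_fun f"
  show "conv f delta x = f x"
  proof (cases "x \<in> carrier G")
    case True
    have "conv f delta x = (\<Sum>y\<in>carrier G. if y = \<one> then f (x \<otimes> inv y) else 0)"
      unfolding conv_flip[OF True] delta_def by (intro sum.cong) auto
    then show ?thesis using True by simp
  qed (use f in \<open>simp add: class_fun_outside\<close>)
qed

lemma cpow_conv:
  assumes "class_fun f" "class_fun g"
  shows "cpow (conv f g) k = conv (cpow f k) (cpow g k)"
proof (induction k)
  case 0
  then show ?case by (simp add: conv_delta_right class_fun_delta)
next
  case (Suc k)
  then show ?case
    using assms by (simp add: conv_assoc conv_left_commute[of g])
qed

lemma cpow_double: "class_fun f \<Longrightarrow> cpow f (2 * k) = cpow (conv f f) k"
  by (induction k) (auto simp: conv_assoc)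

lemma class_fun_add: "class_fun f \<Longrightarrow> class_fun g \<Longrightarrow> class_fun (\<lambda>x. f x + g x)"
  by (simp add: class_fun_def)

lemma class_fun_cmult: "class_fun f \<Longrightarrow> class_fun (\<lambda>x. c * f x)"
  by (simp add: class_fun_def)

lemma class_fun_sum:
  "(\<And>j. j \<in> A \<Longrightarrow> class_fun (f j)) \<Longrightarrow> class_fun (\<lambda>x. \<Sum>j\<in>A. c j * f j x)"
  by (simp add: class_fun_def)

lemma conv_add_left: "conv (\<lambda>x. f x + g x) h = (\<lambda>x. conv f h x + conv g h x)"
  by (auto simp: conv_def sum.distrib distrib_right fun_eq_iff)

lemma conv_add_right: "conv h (\<lambda>x. f x + g x) = (\<lambda>x. conv h f x + conv h g x)"
  by (auto simp: conv_def sum.distrib distrib_left fun_eq_iff)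

lemma conv_cmult_right: "conv f (\<lambda>x. c * g x) = (\<lambda>x. c * conv f g x)"
  by (auto simp: conv_def sum_distrib_left fun_eq_iff mult_ac)

lemma conv_cmult_left: "conv (\<lambda>x. c * f x) g = (\<lambda>x. c * conv f g x)"
  by (auto simp: conv_def sum_distrib_left fun_eq_iff mult_ac)

lemma conv_sum_right:
  "conv f (\<lambda>x. \<Sum>j\<in>A. c j * g j x) = (\<lambda>x. \<Sum>j\<in>A. c j * conv f (g j) x)"
proof
  fix x
  show "conv f (\<lambda>x. \<Sum>j\<in>A. c j * g j x) x = (\<Sum>j\<in>A. c j * conv f (g j) x)"
    unfolding conv_def
    by (auto simp: sum_distrib_left mult_ac intro: sum.swap)
qed

lemma class_fun_all_one: "class_fun all_one"
  by (simp add: class_fun_def all_one_def)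

lemma conv_all_one: "conv f all_one = (\<lambda>x. mass f * all_one x)"
  by (auto simp: conv_def all_one_def mass_def sum_distrib_right fun_eq_iff intro!: sum.cong)

lemma mass_conv: "mass (conv f g) = mass f * mass g"
proof -
  have "mass (conv f g) = (\<Sum>x\<in>carrier G. \<Sum>y\<in>carrier G. f y * g (inv y \<otimes> x))"
    by (simp add: mass_def conv_def)
  also have "\<dots> = (\<Sum>y\<in>carrier G. \<Sum>x\<in>carrier G. f y * g (inv y \<otimes> x))" by (rule sum.swap)
  also have "\<dots> = (\<Sum>y\<in>carrier G. f y * mass g)"
    by (intro sum.cong refl) (simp add: sum_distrib_left[symmetric] sum_left_translate mass_def)
  finally show ?thesis by (simp add: mass_def sum_distrib_right)
qed

lemma mass_all_one: "mass all_one = int (order G)"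
  by (simp add: mass_def all_one_def Coset.order_def)

lemma conv_inverse:
  assumes "x \<in> carrier G"
  shows "conv f g (inv x) = conv (\<lambda>x. g (inv x)) (\<lambda>x. f (inv x)) x"
proof -
  have "conv f g (inv x) = (\<Sum>y\<in>carrier G. f (inv y) * g (inv (inv y) \<otimes> inv x))"
    using assms sum_inverse[of "\<lambda>y. f y * g (inv y \<otimes> inv x)"] by (simp add: conv_def)
  also have "\<dots> = (\<Sum>y\<in>carrier G. g (inv (x \<otimes> inv y)) * f (inv y))"
    using assms by (intro sum.cong refl) (simp add: inv_mult_group)
  also have "\<dots> = conv (\<lambda>x. g (inv x)) (\<lambda>x. f (inv x)) x"
    unfolding conv_flip[OF assms] by simp
  finally show ?thesis .
qed

end

section \<open>The Frobenius map on class functions\<close>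

text \<open>
  A map of prime order \<open>q\<close> has orbits of size \<open>1\<close> and \<open>q\<close>, and those of size \<open>q\<close> contribute a
  multiple of \<open>q\<close>.
\<close>

lemma sum_cong_fixed_points:
  fixes F :: "'a \<Rightarrow> int"
  assumes "prime q" "finite S"
    and "\<And>x. x \<in> S \<Longrightarrow> \<tau> x \<in> S" "\<And>x. x \<in> S \<Longrightarrow> (\<tau> ^^ q) x = x" "\<And>x. x \<in> S \<Longrightarrow> F (\<tau> x) = F x"
  shows "[sum F S = sum F {x\<in>S. \<tau> x = x}] (mod int q)"
  using assms(2-)
proof (induction S rule: finite_psubset_induct)
  case (psubset S)
  have "q > 0" using assms(1) prime_gt_0_nat by blast
  show ?case
  proof (cases "\<forall>x\<in>S. \<tau> x = x")
    case True
    then have "{x\<in>S. \<tau> x = x} = S" by auto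
    then show ?thesis by simp
  next
    case False
    then obtain x where x: "x \<in> S" "\<tau> x \<noteq> x" by blast
    have per: "(\<tau> ^^ q) x = x" using psubset.prems x by blast
    have period: "\<tau> y = y" if "(\<tau> ^^ d) y = y" "0 < d" "d < q" "(\<tau> ^^ q) y = y" for d y
    proof -
      have "coprime d q" using that assms(1)
        by (metis coprime_commute nat_dvd_not_less prime_imp_coprime_nat)
      then obtain u where u: "(d * u) mod q = 1 mod q"
        using cong_solve_coprime_nat unfolding cong_def by (metis One_nat_def)
      have "y = (\<tau> ^^ ((d * u) mod d)) y" by simp
      also have "\<dots> = (\<tau> ^^ (d * u)) y" using that(1) by (rule funpow_mod_eq)
      also have "\<dots> = (\<tau> ^^ ((d * u) mod q)) y" using that(4) by (rule funpow_mod_eq[symmetric])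
      also have "\<dots> = (\<tau> ^^ 1) y" unfolding u using that(4) by (rule funpow_mod_eq)
      finally show ?thesis by simp
    qed
    define orb where "orb = (\<lambda>i. (\<tau> ^^ i) x) ` {..<q}"
    have in_S: "(\<tau> ^^ i) x \<in> S" for i
      using x psubset.prems(1) by (induction i) auto
    have in_orb: "(\<tau> ^^ i) x \<in> orb" for i
      unfolding orb_def using funpow_mod_eq[OF per, of i] \<open>q > 0\<close>
      by (intro image_eqI[of _ _ "i mod q"]) auto
    have F_orb: "F ((\<tau> ^^ i) x) = F x" for i
      using in_S psubset.prems(3) by (induction i) auto
    have wrap: "(\<tau> ^^ (q - i)) ((\<tau> ^^ i) x) = x" if "i \<le> q" for i
    proof -
      have "(\<tau> ^^ (q - i)) ((\<tau> ^^ i) x) = (\<tau> ^^ (q - i + i)) x" by (simp add: funpow_add)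
      then show ?thesis using that per by simp
    qed
    have lt: "i = j" if "(\<tau> ^^ i) x = (\<tau> ^^ j) x" "i \<le> j" "j < q" for i j
    proof (rule ccontr)
      assume "i \<noteq> j"
      have "(\<tau> ^^ (q - i)) ((\<tau> ^^ i) x) = x"
        using that by (intro wrap) simp
      moreover have "(\<tau> ^^ (q - i)) ((\<tau> ^^ j) x) = (\<tau> ^^ (j - i)) x"
      proof -
        have "(\<tau> ^^ (q - i)) ((\<tau> ^^ j) x) = (\<tau> ^^ (q - i + j)) x" by (simp add: funpow_add)
        also have "q - i + j = (j - i) + q" using that by simp
        also have "(\<tau> ^^ ((j - i) + q)) x = (\<tau> ^^ (j - i)) x" using per by (simp add: funpow_add)
        finally show ?thesis .
      qed
      ultimately have "(\<tau> ^^ (j - i)) x = x" using that(1) by simp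
      then have "\<tau> x = x" using period[of "j - i" x] per that \<open>i \<noteq> j\<close> by simp
      then show False using x by simp
    qed
    have inj: "inj_on (\<lambda>i. (\<tau> ^^ i) x) {..<q}"
    proof (rule inj_onI)
      fix i j assume "i \<in> {..<q}" "j \<in> {..<q}" "(\<tau> ^^ i) x = (\<tau> ^^ j) x"
      then show "i = j" using lt[of i j] lt[of j i] by (cases "i \<le> j") auto
    qed
    have not_fixed: "\<tau> y \<noteq> y" if y: "y \<in> orb" for y
    proof
      assume "\<tau> y = y"
      obtain i where i: "y = (\<tau> ^^ i) x" "i < q" using y by (auto simp: orb_def)
      have "(\<tau> ^^ m) y = y" for m using \<open>\<tau> y = y\<close> by (induction m) auto
      then have "y = (\<tau> ^^ (q - i)) ((\<tau> ^^ i) x)" using i by metis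
      also have "\<dots> = x" using i by (intro wrap) simp
      finally show False using \<open>\<tau> y = y\<close> x by simp
    qed
    have "orb \<subseteq> S" using in_S by (auto simp: orb_def)
    have closed: "\<tau> y \<in> S - orb" if y: "y \<in> S - orb" for y
    proof -
      have "\<tau> y \<notin> orb"
      proof
        assume "\<tau> y \<in> orb"
        then obtain i where i: "\<tau> y = (\<tau> ^^ i) x" by (auto simp: orb_def)
        have "y = (\<tau> ^^ (q - 1)) (\<tau> y)"
          using psubset.prems(2)[of y] y \<open>q > 0\<close> by (cases q) (auto simp: funpow_swap1)
        also have "\<dots> = (\<tau> ^^ (q - 1 + i)) x" unfolding i by (simp add: funpow_add)
        finally show False using in_orb y by simp
      qed
      then show ?thesis using psubset.prems(1) y by blast
    qed
    have "S - orb \<subset> S" using in_orb[of 0] x by auto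
    then have IH: "[sum F (S - orb) = sum F {x\<in>S - orb. \<tau> x = x}] (mod int q)"
      using psubset.IH[of "S - orb"] closed psubset.prems by simp
    have "{x\<in>S - orb. \<tau> x = x} = {x\<in>S. \<tau> x = x}" using not_fixed by auto
    moreover have "sum F S = sum F (S - orb) + sum F orb"
      using \<open>orb \<subseteq> S\<close> psubset.hyps by (simp add: sum.subset_diff)
    moreover have "sum F orb = int q * F x"
      using F_orb by (simp add: orb_def sum.reindex[OF inj])
    ultimately show ?thesis
      using cong_add[OF IH, of "sum F orb" 0] by (simp add: cong_0_iff)
  qed
qed

context finite_grp
begin

text \<open>
  If \<open>b\<close> inverts \<open>q\<close> modulo the order of the group, this sends the indicator of a class \<open>C\<close> to the
  indicator of \<open>C\<^sup>q\<close>.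
\<close>

definition twist :: "int \<Rightarrow> ('a \<Rightarrow> int) \<Rightarrow> 'a \<Rightarrow> int" where
  "twist b f = (\<lambda>x. if x \<in> carrier G then f (x [^] b) else 0)"

definition list_mult :: "'a list \<Rightarrow> 'a" where
  "list_mult xs = foldr (\<otimes>) xs \<one>"

lemma list_mult_simps [simp]:
  "list_mult [] = \<one>" "list_mult (x # xs) = x \<otimes> list_mult xs"
  by (simp_all add: list_mult_def)

lemma list_mult_closed [simp]: "set xs \<subseteq> carrier G \<Longrightarrow> list_mult xs \<in> carrier G"
  by (induction xs) auto

lemma list_mult_snoc:
  "set xs \<subseteq> carrier G \<Longrightarrow> y \<in> carrier G \<Longrightarrow> list_mult (xs @ [y]) = list_mult xs \<otimes> y"
  by (induction xs) (auto simp: m_assoc)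

lemma list_mult_replicate: "x \<in> carrier G \<Longrightarrow> list_mult (replicate k x) = x [^] k"
  by (induction k) (auto simp: nat_pow_Suc2[symmetric] simp del: nat_pow_Suc)

lemma finite_lists: "finite {xs. set xs \<subseteq> carrier G \<and> length xs = k \<and> P xs}"
  by (rule finite_subset[OF _ finite_lists_length_eq[OF fin, of k]]) auto

text \<open>
  Expanding a convolution power over the factorizations of \<open>x\<close> makes cyclic rotation available.
\<close>

lemma cpow_eq_sum_lists:
  assumes "x \<in> carrier G"
  shows "cpow f k x =
    (\<Sum>xs | set xs \<subseteq> carrier G \<and> length xs = k \<and> list_mult xs = x. prod_list (map f xs))"
  using assms
proof (induction k arbitrary: x)
  case 0
  have "{xs. set xs \<subseteq> carrier G \<and> length xs = 0 \<and> list_mult xs = x} = (if x = \<one> then {[]} else {})"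
    by auto
  then show ?case by (simp add: delta_def)
next
  case (Suc k)
  let ?T = "\<lambda>k x. {xs. set xs \<subseteq> carrier G \<and> length xs = k \<and> list_mult xs = x}"
  have "cpow f (Suc k) x =
      (\<Sum>y\<in>carrier G. \<Sum>xs\<in>?T k (inv y \<otimes> x). f y * prod_list (map f xs))"
    using Suc by (simp add: conv_def sum_distrib_left)
  also have "\<dots> = (\<Sum>(y, xs)\<in>Sigma (carrier G) (\<lambda>y. ?T k (inv y \<otimes> x)). f y * prod_list (map f xs))"
    by (rule sum.Sigma) (auto intro: finite_lists)
  also have "\<dots> = (\<Sum>xs\<in>?T (Suc k) x. prod_list (map f xs))"
  proof (rule sum.reindex_bij_witness[where j = "\<lambda>(y, xs). y # xs" and i = "\<lambda>xs. (hd xs, tl xs)"], goal_cases)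
    case (2 a)
    then show ?case using Suc.prems by (auto simp: m_assoc[symmetric])
  next
    case (4 b)
    then obtain y ys where b: "b = y # ys" by (cases b) auto
    then show ?case using 4 by (auto simp: m_assoc[symmetric])
  qed (auto simp: length_Suc_conv)
  finally show ?case .
qed

lemma conj_class_closed: "x \<in> carrier G \<Longrightarrow> conj_class G x \<subseteq> carrier G"
  by (auto simp: conj_class_eq)

lemma self_in_conj_class: "x \<in> carrier G \<Longrightarrow> x \<in> conj_class G x"
  by (auto simp: conj_class_eq intro!: image_eqI[of _ _ \<one>])

lemma conj_class_conj:
  assumes "x \<in> carrier G" "y \<in> conj_class G x" "g \<in> carrier G"
  shows "g \<otimes> y \<otimes> inv g \<in> conj_class G x"
proof -
  obtain h where h: "h \<in> carrier G" "y = h \<otimes> x \<otimes> inv h" using assms by (auto simp: conj_class_eq)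
  then have "g \<otimes> y \<otimes> inv g = (g \<otimes> h) \<otimes> x \<otimes> inv (g \<otimes> h)"
    using assms by (simp add: m_assoc inv_mult_group)
  then show ?thesis using assms h by (auto simp: conj_class_eq)
qed

lemma conj_class_one: "conj_class G \<one> = {\<one>}"
  by (auto simp: conj_class_eq intro!: image_eqI[of _ _ \<one>])

lemma conj_class_sym:
  assumes "y \<in> carrier G" "z \<in> conj_class G y"
  shows "y \<in> conj_class G z"
proof -
  obtain h where h: "h \<in> carrier G" "z = h \<otimes> y \<otimes> inv h" using assms by (auto simp: conj_class_eq)
  then have z: "z \<in> carrier G" using assms by simp
  have "inv h \<otimes> z \<otimes> inv (inv h) = y"
    using h assms by (simp add: m_assoc[symmetric]) (simp add: m_assoc)
  then show ?thesis unfolding conj_class_eq[OF z] using h(1) by (intro image_eqI[of _ _ "inv h"]) auto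
qed

lemma conj_class_absorb:
  assumes "y \<in> carrier G" "z \<in> conj_class G y"
  shows "conj_class G z = conj_class G y"
proof -
  have sub: "conj_class G z \<subseteq> conj_class G y" if "y \<in> carrier G" "z \<in> conj_class G y" for y z
  proof
    fix w assume "w \<in> conj_class G z"
    moreover have "z \<in> carrier G" using that conj_class_closed by blast
    ultimately obtain h where "h \<in> carrier G" "w = h \<otimes> z \<otimes> inv h" by (auto simp: conj_class_eq)
    then show "w \<in> conj_class G y" using conj_class_conj that by blast
  qed
  have "z \<in> carrier G" using assms conj_class_closed by blast
  then show ?thesis using sub[OF assms] sub[of z y] conj_class_sym[OF assms] by blast
qed

lemma class_fun_on_class: "class_fun f \<Longrightarrow> x \<in> carrier G \<Longrightarrow> y \<in> conj_class G x \<Longrightarrow> f y = f x"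
  by (auto simp: conj_class_eq class_fun_conj)

lemma card_conj_class_dvd:
  assumes "x \<in> carrier G"
  shows "card (conj_class G x) dvd order G"
proof -
  interpret conj: group_action G "carrier G" "conj_action G"
    unfolding conj_action_def by (rule action_by_conjugation)
  show ?thesis
    using conj.orbit_stabilizer_theorem[OF assms] unfolding conj_class_def by (metis dvd_triv_left)
qed

lemma pow_cong:
  assumes "x \<in> carrier G" "[a = b] (mod int (order G))"
  shows "x [^] a = x [^] b"
proof -
  obtain k where k: "a = b + int (order G) * k"
    using assms(2) by (metis cong_iff_lin cong_sym mult.commute)
  have "x [^] int (order G) = \<one>"
    using assms(1) by (simp add: int_pow_int pow_order_eq_1)
  then have "x [^] (int (order G) * k) = \<one>"
    using assms(1) by (metis int_pow_pow int_pow_one)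
  then show ?thesis using assms(1) by (simp add: k int_pow_mult)
qed

lemma pow_inverse_exponents:
  assumes "x \<in> carrier G" "[a * b = 1] (mod int (order G))"
  shows "(x [^] a) [^] b = x"
  using pow_cong[OF assms] assms(1) by (simp add: int_pow_pow)

text \<open>
  The sum of \<open>f\<^sup>q\<close> over a class \<open>X\<close> runs over the \<open>q\<close>-tuples with product in \<open>X\<close>. Rotating a tuple
  conjugates its product, so these tuples are permuted by rotation, and modulo \<open>q\<close> only the constant
  tuples count: they are the \<open>q\<close>-th roots of elements of \<open>X\<close>. Both sides are constant on \<open>X\<close>, whose
  size divides the group order and is therefore invertible modulo \<open>q\<close>.
\<close>

lemma frobenius:
  assumes f: "class_fun f" and q: "prime q" "coprime q (order G)"
    and b: "[int q * b = 1] (mod int (order G))"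
  shows "[cpow f q x = twist b f x] (mod int q)"
proof (cases "x \<in> carrier G")
  case x: True
  define X where "X = conj_class G x"
  have X: "X \<subseteq> carrier G" "x \<in> X" "finite X"
    using conj_class_closed[OF x] self_in_conj_class[OF x] fin finite_subset by (auto simp: X_def)
  define S where "S = {xs. set xs \<subseteq> carrier G \<and> length xs = q \<and> list_mult xs \<in> X}"
  define F where "F = (\<lambda>xs. prod_list (map f xs))"
  have fixed: "{xs\<in>S. rotate1 xs = xs} = replicate q ` {g\<in>carrier G. g [^] q \<in> X}"
  proof (intro equalityI subsetI)
    fix xs assume xs: "xs \<in> {xs\<in>S. rotate1 xs = xs}"
    then have "xs \<noteq> []" using q prime_gt_0_nat[of q] by (auto simp: S_def)
    then obtain g where "set xs = {g}" using rotate1_fixpoint_card[of xs] xs card_1_singletonE by auto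
    then have "xs = replicate q g" using xs by (intro replicate_eqI) (auto simp: S_def)
    then show "xs \<in> replicate q ` {g\<in>carrier G. g [^] q \<in> X}"
      using xs \<open>set xs = {g}\<close> by (auto simp: S_def list_mult_replicate)
  next
    fix xs assume "xs \<in> replicate q ` {g\<in>carrier G. g [^] q \<in> X}"
    then show "xs \<in> {xs\<in>S. rotate1 xs = xs}"
      by (auto simp: S_def list_mult_replicate rotate1_replicate split: if_splits)
  qed
  have "sum F S = (\<Sum>y\<in>X. cpow f q y)"
  proof -
    have "(\<Sum>y\<in>X. cpow f q y) = (\<Sum>y\<in>X. \<Sum>xs | xs \<in> S \<and> list_mult xs = y. F xs)"
      using X by (intro sum.cong refl) (auto simp: S_def F_def cpow_eq_sum_lists intro!: sum.cong)
    also have "\<dots> = sum F S"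
      by (rule sum.group) (auto simp: S_def X intro: finite_lists)
    finally show ?thesis by simp
  qed
  also have "\<dots> = int (card X) * cpow f q x"
    using class_fun_on_class[OF class_fun_cpow[OF f] x] by (simp add: X_def)
  finally have 1: "sum F S = int (card X) * cpow f q x" .
  have "[sum F S = sum F {xs\<in>S. rotate1 xs = xs}] (mod int q)"
  proof (rule sum_cong_fixed_points[OF q(1)])
    show "finite S" unfolding S_def by (rule finite_lists)
    show "rotate1 xs \<in> S" if "xs \<in> S" for xs
    proof (cases xs)
      case (Cons y ys)
      have yc: "y \<in> carrier G" "set ys \<subseteq> carrier G" using that Cons by (auto simp: S_def)
      have "inv y \<otimes> list_mult xs \<otimes> inv (inv y) \<in> X"
        unfolding X_def using that x yc by (intro conj_class_conj) (auto simp: S_def X_def)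
      also have "inv y \<otimes> list_mult xs \<otimes> inv (inv y) = list_mult (rotate1 xs)"
        using yc Cons by (simp add: list_mult_snoc m_assoc[symmetric])
      finally show ?thesis using that by (simp add: S_def)
    qed (use that in simp)
    show "(rotate1 ^^ q) xs = xs" if "xs \<in> S" for xs
      using rotate_id[of q xs] that by (simp add: S_def rotate_def)
    show "F (rotate1 xs) = F xs" if "xs \<in> S" for xs
      by (cases xs) (auto simp: F_def mult.commute)
  qed
  also have "sum F {xs\<in>S. rotate1 xs = xs} = (\<Sum>g | g \<in> carrier G \<and> g [^] q \<in> X. f g ^ q)"
    unfolding fixed using q prime_gt_0_nat[of q]
    by (subst sum.reindex) (auto simp: inj_on_def F_def replicate_eq_replicate)
  also have "[\<dots> = (\<Sum>g | g \<in> carrier G \<and> g [^] q \<in> X. f g)] (mod int q)"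
    by (intro cong_sum fermat_int_prime q)
  also have "(\<Sum>g | g \<in> carrier G \<and> g [^] q \<in> X. f g) = (\<Sum>y\<in>X. f (y [^] b))"
  proof (rule sum.reindex_bij_witness[where j = "\<lambda>g. g [^] q" and i = "\<lambda>y. y [^] b"])
    show pow1: "(g [^] q) [^] b = g" if "g \<in> {g. g \<in> carrier G \<and> g [^] q \<in> X}" for g
      using that pow_inverse_exponents[of g "int q" b] b by (simp add: int_pow_int)
    show pow2: "(y [^] b) [^] q = y" if "y \<in> X" for y
      using that X pow_inverse_exponents[of y b "int q"] b by (auto simp: int_pow_int mult.commute)
    then show "y [^] b \<in> {g. g \<in> carrier G \<and> g [^] q \<in> X}" if "y \<in> X" for y
      using that X by auto
  qed (use b pow_inverse_exponents[of _ "int q" b] in \<open>auto simp: int_pow_int\<close>)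
  also have "\<dots> = int (card X) * twist b f x"
  proof -
    have "f (y [^] b) = f (x [^] b)" if "y \<in> X" for y
      using that x f by (auto simp: X_def conj_class_eq conj_int_pow class_fun_conj)
    then show ?thesis using x by (simp add: twist_def)
  qed
  finally have "[int (card X) * cpow f q x = int (card X) * twist b f x] (mod int q)"
    unfolding 1 .
  moreover have "coprime (int (card X)) (int q)"
    using card_conj_class_dvd[OF x] q(2) unfolding X_def
    by (metis coprime_commute coprime_divisors coprime_int_iff dvd_refl)
  ultimately show ?thesis using cong_mult_lcancel by blast
next
  case False
  then have "cpow f q x = 0" using class_fun_outside class_fun_cpow f by blast
  then show ?thesis using False by (simp add: twist_def)
qed

section \<open>Reduced class functions and regular antisymmetric elements\<close>

definition antisym_fun :: "('a \<Rightarrow> int) \<Rightarrow> bool" where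
  "antisym_fun f \<longleftrightarrow> class_fun f \<and> (\<forall>y\<in>carrier G. f (inv y) = - f y)"

lemma antisym_fun_add: "antisym_fun f \<Longrightarrow> antisym_fun g \<Longrightarrow> antisym_fun (\<lambda>x. f x + g x)"
  by (simp add: antisym_fun_def class_fun_add)

lemma conv_cong_zero_right:
  assumes "\<And>x. [g x = 0] (mod m)"
  shows "[conv f g x = 0] (mod m)"
proof (cases "x \<in> carrier G")
  case True
  have "[(\<Sum>y\<in>carrier G. f y * g (inv y \<otimes> x)) = (\<Sum>y\<in>carrier G. f y * 0)] (mod m)"
    by (intro cong_sum cong_mult cong_refl assms)
  then show ?thesis using True by (simp add: conv_def)
qed simp

lemma conv_cong_mod_right:
  assumes "\<And>x. [g x = h x] (mod m)"
  shows "[conv f g x = conv f h x] (mod m)"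
proof (cases "x \<in> carrier G")
  case True
  have "[(\<Sum>y\<in>carrier G. f y * g (inv y \<otimes> x)) = (\<Sum>y\<in>carrier G. f y * h (inv y \<otimes> x))] (mod m)"
    by (intro cong_sum cong_mult cong_refl assms)
  then show ?thesis using True by (simp add: conv_def)
qed simp

lemma inverse_exponent:
  assumes "coprime q (order G)"
  obtains b where "[int q * b = 1] (mod int (order G))"
  using assms cong_solve_coprime_int[of "int q" "int (order G)"] by auto

text \<open>
  A function with square zero also has \<open>q\<close>-th power zero, but the Frobenius map is a permutation of the
  values.
\<close>

lemma zero_if_square_zero_mod:
  assumes f: "class_fun f" and q: "prime q" "coprime q (order G)"
    and "\<And>x. [conv f f x = 0] (mod int q)"
  shows "[f x = 0] (mod int q)"
proof (cases "x \<in> carrier G")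
  case x: True
  obtain b where b: "[int q * b = 1] (mod int (order G))" using inverse_exponent[OF q(2)] .
  obtain m where m: "q = Suc (Suc m)" using q(1) prime_ge_2_nat[of q] by (metis add_2_eq_Suc le_Suc_ex)
  have "cpow f q = conv (cpow f m) (conv f f)"
    using conv_commute[OF class_fun_cpow[OF f], of m "conv f f"] by (simp add: m conv_assoc)
  then have "[cpow f q y = 0] (mod int q)" for y
    using conv_cong_zero_right[OF assms(4)] by simp
  then have "[twist b f (x [^] int q) = 0] (mod int q)"
    using frobenius[OF f q b] cong_trans cong_sym by blast
  then show ?thesis using x pow_inverse_exponents[OF x b] by (simp add: twist_def)
next
  case False
  then show ?thesis using f by (simp add: class_fun_outside)
qed

text \<open>
  Choose \<open>\<iota>\<close> with the smallest annihilator among the antisymmetric functions modulo \<open>q\<close>. If \<open>z\<close> is in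
  this annihilator, then whatever kills \<open>\<iota> + z\<close> kills \<open>z\<^sup>2\<close>, hence \<open>z\<close> because there are no
  nilpotents, and hence \<open>\<iota>\<close>. So \<open>\<iota> + z\<close> has a smaller annihilator, strictly smaller because it
  does not contain \<open>z\<close> unless \<open>z\<close> is zero.
\<close>

lemma regular_antisym_fun_exists:
  assumes q: "prime q" "coprime q (order G)"
  obtains \<iota> where "antisym_fun \<iota>"
    "\<And>z. antisym_fun z \<Longrightarrow> (\<And>x. [conv \<iota> z x = 0] (mod int q)) \<Longrightarrow> (\<And>x. [z x = 0] (mod int q))"
proof -
  define red where "red = (\<lambda>z :: 'a \<Rightarrow> int. \<lambda>x\<in>carrier G. z x mod int q)"
  \<comment> \<open>Annihilators are compared through residues, which makes them finite.\<close>
  define ann where "ann = (\<lambda>\<iota>. red ` {z. antisym_fun z \<and> (\<forall>x. [conv \<iota> z x = 0] (mod int q))})"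
  have "q > 0" using q prime_gt_0_nat by blast
  have fin_ann: "finite (ann \<iota>)" for \<iota>
  proof (rule finite_subset)
    show "ann \<iota> \<subseteq> carrier G \<rightarrow>\<^sub>E {0..<int q}"
      using \<open>q > 0\<close> by (auto simp: ann_def red_def)
    show "finite (carrier G \<rightarrow>\<^sub>E {0..<int q})" by (intro finite_PiE) auto
  qed
  have "antisym_fun (\<lambda>_. 0)" by (simp add: antisym_fun_def class_fun_def)
  then obtain \<iota> where \<iota>: "antisym_fun \<iota>" "\<And>\<iota>'. antisym_fun \<iota>' \<Longrightarrow> card (ann \<iota>) \<le> card (ann \<iota>')"
    using ex_has_least_nat[of antisym_fun "\<lambda>_. 0" "\<lambda>\<iota>. card (ann \<iota>)"] by blast
  have "[z x = 0] (mod int q)" if z: "antisym_fun z" "\<And>x. [conv \<iota> z x = 0] (mod int q)" for z x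
  proof (rule ccontr)
    assume nz: "\<not> [z x = 0] (mod int q)"
    define \<iota>' where "\<iota>' = (\<lambda>x. \<iota> x + z x)"
    have \<iota>': "antisym_fun \<iota>'" unfolding \<iota>'_def using \<iota>(1) z(1) by (rule antisym_fun_add)
    have cf: "class_fun \<iota>" "class_fun z" using \<iota>(1) z(1) by (auto simp: antisym_fun_def)
    have z_ann: "[conv z w y = 0] (mod int q)"
      if w: "antisym_fun w" "\<And>x. [conv \<iota>' w x = 0] (mod int q)" for w y
    proof -
      have w': "class_fun w" using w(1) by (auto simp: antisym_fun_def)
      have zero: "[conv z (conv \<iota> w) x = 0] (mod int q)" for x
      proof -
        have "conv z (conv \<iota> w) = conv w (conv \<iota> z)"
          using cf w' by (metis conv_assoc conv_commute)
        then show ?thesis using conv_cong_zero_right[OF z(2)] by simp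
      qed
      have "[conv z (conv z w) x = 0] (mod int q)" for x
      proof -
        have "conv z (conv \<iota>' w) = (\<lambda>x. conv z (conv \<iota> w) x + conv z (conv z w) x)"
          by (simp add: \<iota>'_def conv_add_left conv_add_right)
        then have "[conv z (conv \<iota> w) x + conv z (conv z w) x = 0] (mod int q)"
          using conv_cong_zero_right[of "conv \<iota>' w" "int q" z x] w(2) by simp
        then show ?thesis using zero[of x] by (simp add: cong_0_iff dvd_add_right_iff)
      qed
      moreover have "conv (conv z w) (conv z w) = conv w (conv z (conv z w))"
        using cf w' by (metis conv_assoc conv_commute)
      ultimately have "[conv (conv z w) (conv z w) x = 0] (mod int q)" for x
        using conv_cong_zero_right by simp
      then show ?thesis using zero_if_square_zero_mod[OF class_fun_conv[OF cf(2) w'] q] by blast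
    qed
    have "ann \<iota>' \<subseteq> ann \<iota>"
    proof
      fix u assume "u \<in> ann \<iota>'"
      then obtain w where w: "u = red w" "antisym_fun w" "\<And>x. [conv \<iota>' w x = 0] (mod int q)"
        by (auto simp: ann_def)
      have "[conv \<iota> w x = 0] (mod int q)" for x
        using w(3)[of x] z_ann[OF w(2,3), of x] unfolding \<iota>'_def conv_add_left
        by (simp add: cong_0_iff dvd_add_left_iff)
      then show "u \<in> ann \<iota>" using w(1,2) by (auto simp: ann_def)
    qed
    moreover have "red z \<in> ann \<iota>" using z by (auto simp: ann_def)
    moreover have "red z \<notin> ann \<iota>'"
    proof
      assume "red z \<in> ann \<iota>'"
      then obtain w where w: "red z = red w" "antisym_fun w" "\<And>x. [conv \<iota>' w x = 0] (mod int q)"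
        by (auto simp: ann_def)
      have "[z y = w y] (mod int q)" for y
        using fun_cong[OF w(1), of y] cf(2) w(2)
        by (cases "y \<in> carrier G") (auto simp: red_def cong_def class_fun_outside antisym_fun_def)
      then have "[conv z z y = 0] (mod int q)" for y
        using conv_cong_mod_right[of z w] z_ann[OF w(2,3)] cong_trans by blast
      then show False using zero_if_square_zero_mod[OF cf(2) q] nz by blast
    qed
    ultimately have "card (ann \<iota>') < card (ann \<iota>)" using fin_ann by (intro psubset_card_mono) auto
    then show False using \<iota>(2)[OF \<iota>'] by simp
  qed
  then show ?thesis using \<iota>(1) that by blast
qed

section \<open>Symmetric and skew class functions\<close>

definition sym_fun :: "('a \<Rightarrow> int) \<Rightarrow> bool" where
  "sym_fun f \<longleftrightarrow> class_fun f \<and> (\<forall>y\<in>carrier G. f (inv y) = f y)"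

text \<open>
  The span of the constant function and the antisymmetric functions: the constant part of \<open>w\<close> is its
  value at the neutral element, where an antisymmetric function vanishes.
\<close>

definition skew_fun :: "('a \<Rightarrow> int) \<Rightarrow> bool" where
  "skew_fun w \<longleftrightarrow> class_fun w \<and> (\<forall>y\<in>carrier G. w y + w (inv y) = 2 * w \<one>)"

lemma conv_cong_carrier:
  assumes "\<And>x. x \<in> carrier G \<Longrightarrow> f x = f' x" "\<And>x. x \<in> carrier G \<Longrightarrow> g x = g' x"
  shows "conv f g = conv f' g'"
  using assms by (auto simp: conv_def fun_eq_iff intro!: sum.cong)

lemma mass_skew:
  assumes "skew_fun w"
  shows "mass w = int (order G) * w \<one>"
proof -
  have "2 * mass w = mass w + (\<Sum>y\<in>carrier G. w (inv y))"
    by (simp add: mass_def sum_inverse)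
  also have "\<dots> = (\<Sum>y\<in>carrier G. 2 * w \<one>)"
    unfolding mass_def sum.distrib[symmetric] using assms
    by (intro sum.cong refl) (simp add: skew_fun_def)
  also have "\<dots> = 2 * (int (order G) * w \<one>)" by (simp add: Coset.order_def)
  finally show ?thesis by simp
qed

lemma all_one_conv: "conv all_one f = (\<lambda>x. mass f * all_one x)"
  using conv_commute[OF class_fun_all_one, of f] by (simp add: conv_all_one)

text \<open>
  A product of two antisymmetric functions is symmetric, and the product with the constant function is
  constant.
\<close>

lemma sym_fun_conv_skew:
  assumes u: "skew_fun u" and w: "skew_fun w"
  shows "sym_fun (conv u w)"
proof -
  have cf: "class_fun u" "class_fun w" using u w by (auto simp: skew_fun_def)
  have "conv u w (inv y) = conv u w y" if y: "y \<in> carrier G" for y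
  proof -
    have flip: "f (inv x) = 2 * f \<one> * all_one x + (-1) * f x" if "skew_fun f" "x \<in> carrier G" for f x
      using that by (auto simp: skew_fun_def all_one_def)
    have "conv u w (inv y) = conv (\<lambda>x. w (inv x)) (\<lambda>x. u (inv x)) y" by (rule conv_inverse[OF y])
    also have "\<dots> = conv (\<lambda>x. 2 * w \<one> * all_one x + (-1) * w x) (\<lambda>x. 2 * u \<one> * all_one x + (-1) * u x) y"
      using conv_cong_carrier[of "\<lambda>x. w (inv x)" "\<lambda>x. 2 * w \<one> * all_one x + (-1) * w x"
          "\<lambda>x. u (inv x)" "\<lambda>x. 2 * u \<one> * all_one x + (-1) * u x"] flip[OF u] flip[OF w] by simp
    also have "\<dots> = conv w u y"
      using y by (simp only: conv_add_left conv_add_right conv_cmult_left conv_cmult_right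
          conv_all_one all_one_conv mass_all_one mass_skew[OF u] mass_skew[OF w])
        (simp add: all_one_def algebra_simps)
    finally show ?thesis using conv_commute[OF cf(1)] by simp
  qed
  then show ?thesis using class_fun_conv[OF cf] by (simp add: sym_fun_def)
qed

lemma skew_fun_conv_sym:
  assumes t: "sym_fun t" and w: "skew_fun w"
  shows "skew_fun (conv t w)"
proof -
  have cf: "class_fun t" "class_fun w" using t w by (auto simp: skew_fun_def sym_fun_def)
  have *: "conv t w y + conv t w (inv y) = 2 * w \<one> * mass t" if y: "y \<in> carrier G" for y
  proof -
    have "conv t w (inv y) = conv (\<lambda>x. w (inv x)) (\<lambda>x. t (inv x)) y" by (rule conv_inverse[OF y])
    also have "\<dots> = conv (\<lambda>x. 2 * w \<one> * all_one x + (-1) * w x) t y"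
      using conv_cong_carrier[of "\<lambda>x. w (inv x)" "\<lambda>x. 2 * w \<one> * all_one x + (-1) * w x"
          "\<lambda>x. t (inv x)" t] t w by (simp add: sym_fun_def skew_fun_def all_one_def algebra_simps)
    also have "\<dots> = 2 * w \<one> * mass t - conv t w y"
      using y conv_commute[OF cf(1), of w]
      by (simp only: conv_add_left conv_cmult_left all_one_conv) (simp add: all_one_def)
    finally show ?thesis by simp
  qed
  show ?thesis
    using * *[of \<one>] class_fun_conv[OF cf] by (auto simp: skew_fun_def)
qed

lemma class_fun_twist: "class_fun f \<Longrightarrow> class_fun (twist b f)"
  by (simp add: class_fun_def twist_def conj_int_pow)

lemma skew_fun_twist:
  assumes "skew_fun w"
  shows "skew_fun (twist b w)"
  using assms class_fun_twist[of w b] by (simp add: skew_fun_def twist_def int_pow_inv)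

end

locale odd_grp = finite_grp +
  assumes odd_order: "odd (order G)"
begin

lemma odd_root:
  obtains m :: nat where "\<And>y. y \<in> carrier G \<Longrightarrow> (y \<otimes> y) [^] m = y"
proof -
  obtain k where k: "order G = 2 * k + 1" using odd_order by (metis oddE)
  have "(y \<otimes> y) [^] Suc k = y" if y: "y \<in> carrier G" for y
  proof -
    have "y \<otimes> y = y [^] (2 :: nat)" using y by (simp add: numeral_2_eq_2)
    then have "(y \<otimes> y) [^] Suc k = y [^] (2 * Suc k)" using y by (simp only: nat_pow_pow)
    also have "2 * Suc k = order G + 1" using k by simp
    also have "y [^] (order G + 1) = y" using y by (simp add: nat_pow_mult[symmetric] pow_order_eq_1)
    finally show ?thesis .
  qed
  then show ?thesis using that by blast
qed

text \<open>
  If \<open>g\<close> conjugates \<open>x\<close> to its inverse, then \<open>g\<^sup>2\<close> commutes with \<open>x\<close>; in odd order \<open>g\<close> is a power of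
  \<open>g\<^sup>2\<close>, so \<open>x\<close> is its own inverse.
\<close>

lemma real_element_trivial:
  assumes x: "x \<in> carrier G" and "inv x \<in> conj_class G x"
  shows "x = \<one>"
proof -
  obtain m :: nat where m: "\<And>y. y \<in> carrier G \<Longrightarrow> (y \<otimes> y) [^] m = y" using odd_root by blast
  obtain g where g: "g \<in> carrier G" "g \<otimes> x \<otimes> inv g = inv x" using assms by (auto simp: conj_class_eq)
  have "g \<otimes> g \<otimes> x \<otimes> inv (g \<otimes> g) = g \<otimes> (g \<otimes> x \<otimes> inv g) \<otimes> inv g"
    using g(1) x by (simp add: inv_mult_group m_assoc)
  also have "\<dots> = x" using conj_inv[OF g(1) x] g x by simp
  finally have "g \<otimes> g \<otimes> x = x \<otimes> (g \<otimes> g)"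
    using g(1) x by (metis inv_solve_right' m_closed inv_closed)
  then have "(g \<otimes> g) [^] m \<otimes> x = x \<otimes> (g \<otimes> g) [^] m"
    using g(1) x by (intro group_commutes_pow) auto
  then have "g \<otimes> x = x \<otimes> g" using m[OF g(1)] by simp
  then have "inv x = x" using g x by (metis inv_solve_right' m_closed)
  then have "x \<otimes> x = \<one>" using x by (metis r_inv)
  then show ?thesis using m[OF x] by (metis nat_pow_one)
qed

end

section \<open>Representatives of the classes up to inversion\<close>

text \<open>
  The classes of \<open>x 1, \<dots>, x r\<close> are a half system: they and their inverses are the classes other than
  that of \<open>x 0 = \<one>\<close>, each once. A symmetric class function is determined by its values at \<open>x 0, \<dots>, x r\<close>.
\<close>

locale half_reps = odd_grp +
  fixes r :: nat and x :: "nat \<Rightarrow> 'a"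
  assumes x_0: "x 0 = \<one>" and x_closed: "i \<le> r \<Longrightarrow> x i \<in> carrier G"
    and cover: "y \<in> carrier G \<Longrightarrow> \<exists>i\<le>r. y \<in> conj_class G (x i) \<or> inv y \<in> conj_class G (x i)"
    and unique: "i \<le> r \<Longrightarrow> j \<le> r \<Longrightarrow> y \<in> carrier G \<Longrightarrow>
      y \<in> conj_class G (x i) \<or> inv y \<in> conj_class G (x i) \<Longrightarrow>
      y \<in> conj_class G (x j) \<or> inv y \<in> conj_class G (x j) \<Longrightarrow> i = j"
begin

text \<open>
  A symmetric class function is constant on the union of a class and its inverse.
\<close>

definition block :: "nat \<Rightarrow> 'a set" where
  "block i = {y \<in> carrier G. y \<in> conj_class G (x i) \<or> inv y \<in> conj_class G (x i)}"

definition index :: "'a \<Rightarrow> nat" where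
  "index y = (SOME i. i \<le> r \<and> y \<in> block i)"

definition weight :: "nat \<Rightarrow> int" where
  "weight i = int (card (block i))"

text \<open>
  For \<open>j > 0\<close> the difference of the indicators of a class and of its inverse; for \<open>j = 0\<close> the constant
  function. These are the basis of \<open>skew_fun\<close>, and \<open>coord\<close> gives the coordinates.
\<close>

definition basis :: "nat \<Rightarrow> 'a \<Rightarrow> int" where
  "basis j y = (if y \<notin> carrier G then 0 else if j = 0 then 1 else
     (if y \<in> conj_class G (x j) then 1 else 0) - (if inv y \<in> conj_class G (x j) then 1 else 0))"

definition coord :: "('a \<Rightarrow> int) \<Rightarrow> nat \<Rightarrow> int" where
  "coord w j = (if j = 0 then w \<one> else w (x j) - w \<one>)"

lemma index: "y \<in> carrier G \<Longrightarrow> index y \<le> r \<and> y \<in> block (index y)"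
  unfolding index_def by (rule someI_ex) (use cover in \<open>auto simp: block_def\<close>)

lemma block_unique: "i \<le> r \<Longrightarrow> j \<le> r \<Longrightarrow> y \<in> block i \<Longrightarrow> y \<in> block j \<Longrightarrow> i = j"
  using unique by (auto simp: block_def)

lemma index_eq: "i \<le> r \<Longrightarrow> y \<in> block i \<Longrightarrow> index y = i"
  using index[of y] block_unique[of "index y" i y] by (auto simp: block_def)

lemma finite_block: "finite (block i)"
  by (rule finite_subset[OF _ fin]) (auto simp: block_def)

lemma x_in_block: "i \<le> r \<Longrightarrow> x i \<in> block i"
  using x_closed self_in_conj_class by (auto simp: block_def)

lemma inv_in_block: "y \<in> block i \<Longrightarrow> inv y \<in> block i"
  by (auto simp: block_def)

lemma block_0: "block 0 = {\<one>}"
  by (auto simp: block_def x_0 conj_class_one)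

lemma not_both:
  assumes "i \<le> r" "i \<noteq> 0" "y \<in> conj_class G (x i)"
  shows "inv y \<notin> conj_class G (x i)"
proof
  assume inv: "inv y \<in> conj_class G (x i)"
  have y: "y \<in> carrier G" using assms x_closed conj_class_closed by blast
  have "inv y \<in> conj_class G y"
    using inv conj_class_absorb[OF x_closed[OF assms(1)] assms(3)] by simp
  then have "y = \<one>" using real_element_trivial y by blast
  then have "y \<in> block 0" "y \<in> block i" using block_0 assms y by (auto simp: block_def)
  then show False using block_unique[of 0 i y] assms by simp
qed

lemma class_fun_x:
  assumes "class_fun f" "y \<in> conj_class G (x i)" "i \<le> r"
  shows "f y = f (x i)"
  using class_fun_on_class[OF assms(1) x_closed[OF assms(3)] assms(2)] .

lemma sym_fun_x:
  assumes f: "sym_fun f" and y: "y \<in> carrier G" and i: "i = index y"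
  shows "f y = f (x i)"
proof -
  have "y \<in> conj_class G (x i) \<or> inv y \<in> conj_class G (x i)" "i \<le> r"
    using index[OF y] i by (auto simp: block_def)
  then show ?thesis using f y class_fun_x[of f y i] class_fun_x[of f "inv y" i]
    by (auto simp: sym_fun_def)
qed

lemma skew_fun_expand:
  assumes w: "skew_fun w"
  shows "w = (\<lambda>y. \<Sum>j<Suc r. coord w j * basis j y)"
proof
  fix y
  have cf: "class_fun w" using w by (simp add: skew_fun_def)
  show "w y = (\<Sum>j<Suc r. coord w j * basis j y)"
  proof (cases "y \<in> carrier G")
    case y: True
    define i where "i = index y"
    have i: "i \<le> r" "y \<in> block i" using index[OF y] by (auto simp: i_def)
    have "coord w j * basis j y = (if j = 0 then w \<one> else 0) + (if j = i then w y - w \<one> else 0)"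
      if "j < Suc r" for j
    proof (cases "j = 0")
      case True
      have "y = \<one>" if "i = 0" using i block_0 that by simp
      then show ?thesis using True y by (auto simp: coord_def basis_def)
    next
      case False
      show ?thesis
      proof (cases "j = i")
        case True
        have "y \<in> conj_class G (x i) \<or> inv y \<in> conj_class G (x i)" using i by (auto simp: block_def)
        then show ?thesis
        proof
          assume *: "y \<in> conj_class G (x i)"
          then show ?thesis
            using True False y * not_both[OF i(1) _ *] class_fun_x[OF cf * i(1)]
            by (simp add: coord_def basis_def)
        next
          assume *: "inv y \<in> conj_class G (x i)"
          have "w y + w (inv y) = 2 * w \<one>" using w y by (simp add: skew_fun_def)
          then show ?thesis
            using True False y * not_both[OF i(1) _ *] class_fun_x[OF cf * i(1)]
            by (simp add: coord_def basis_def)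
        qed
      next
        case False
        then have "y \<notin> block j" using block_unique[of i j y] i that by auto
        then show ?thesis using False \<open>j \<noteq> 0\<close> y by (simp add: basis_def block_def)
      qed
    qed
    then have "(\<Sum>j<Suc r. coord w j * basis j y) =
        (\<Sum>j<Suc r. (if j = 0 then w \<one> else 0) + (if j = i then w y - w \<one> else 0))"
      by (intro sum.cong) auto
    also have "\<dots> = w y" using i by (simp add: sum.distrib sum.delta' del: sum.lessThan_Suc)
    finally show ?thesis by simp
  next
    case False
    then show ?thesis using cf by (simp add: class_fun_outside basis_def)
  qed
qed

lemma conj_mem_iff:
  assumes "i \<le> r" "g \<in> carrier G" "y \<in> carrier G"
  shows "g \<otimes> y \<otimes> inv g \<in> conj_class G (x i) \<longleftrightarrow> y \<in> conj_class G (x i)"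
proof
  assume "g \<otimes> y \<otimes> inv g \<in> conj_class G (x i)"
  then have "inv g \<otimes> (g \<otimes> y \<otimes> inv g) \<otimes> inv (inv g) \<in> conj_class G (x i)"
    using conj_class_conj[OF x_closed[OF assms(1)], of "g \<otimes> y \<otimes> inv g" "inv g"] assms inv_closed by blast
  also have "inv g \<otimes> (g \<otimes> y \<otimes> inv g) \<otimes> inv (inv g) = y"
    using assms by (simp add: m_assoc[symmetric]) (simp add: m_assoc)
  finally show "y \<in> conj_class G (x i)" .
qed (use assms x_closed conj_class_conj in blast)

lemma class_fun_basis: "j \<le> r \<Longrightarrow> class_fun (basis j)"
  by (auto simp: class_fun_def basis_def conj_mem_iff conj_inv)

lemma one_notin_class:
  assumes "j \<le> r" "j \<noteq> 0"
  shows "\<one> \<notin> conj_class G (x j)"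
proof
  assume "\<one> \<in> conj_class G (x j)"
  then have "\<one> \<in> block j" by (simp add: block_def)
  then show False using block_unique[of 0 j \<one>] block_0 assms by simp
qed

lemma basis_one: "j \<le> r \<Longrightarrow> basis j \<one> = (if j = 0 then 1 else 0)"
  using one_notin_class by (simp add: basis_def)

lemma skew_fun_basis: "j \<le> r \<Longrightarrow> skew_fun (basis j)"
  using class_fun_basis basis_one by (auto simp: skew_fun_def basis_def)

lemma all_one_one: "all_one \<one> = 1"
  by (simp add: all_one_def)

lemma basis_0: "basis 0 = all_one"
  by (auto simp: basis_def all_one_def)

lemma coord_basis:
  assumes "j \<le> r" "c \<le> r"
  shows "coord (basis j) c = (if c = j then 1 else 0)"
proof -
  consider "c = 0" | "c \<noteq> 0" "j = 0" | "c \<noteq> 0" "j \<noteq> 0" "c = j" | "c \<noteq> 0" "j \<noteq> 0" "c \<noteq> j" by blast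
  then show ?thesis
  proof cases
    case 3
    then show ?thesis
      using assms x_closed[of j] self_in_conj_class not_both[of j "x j"] basis_one
      by (simp add: coord_def basis_def)
  next
    case 4
    then have "x c \<notin> block j" using block_unique[of c j "x c"] x_in_block assms by auto
    then show ?thesis using 4 assms x_closed[of c] basis_one
      by (simp add: coord_def basis_def block_def)
  qed (use assms x_closed basis_one in \<open>auto simp: coord_def basis_def\<close>)
qed

lemma carrier_eq_UN_block: "carrier G = (\<Union>i<Suc r. block i)"
proof (intro equalityI subsetI)
  fix y assume "y \<in> carrier G"
  then show "y \<in> (\<Union>i<Suc r. block i)" using index[of y] by (intro UN_I[of "index y"]) auto
qed (auto simp: block_def)

lemma sum_carrier_block: "(\<Sum>y\<in>carrier G. (f y :: int)) = (\<Sum>i<Suc r. \<Sum>y\<in>block i. f y)"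
  unfolding carrier_eq_UN_block
  by (rule sum.UNION_disjoint) (use finite_block block_unique in \<open>auto simp: less_Suc_eq_le disjoint_iff\<close>)

lemma sum_sym_fun:
  assumes "\<And>i y. i \<le> r \<Longrightarrow> y \<in> block i \<Longrightarrow> f y = f (x i)"
  shows "(\<Sum>y\<in>carrier G. f y) = (\<Sum>i<Suc r. weight i * f (x i))"
proof -
  have "(\<Sum>y\<in>block i. f y) = weight i * f (x i)" if "i < Suc r" for i
    using assms[of i] that by (simp add: weight_def less_Suc_eq_le)
  then show ?thesis unfolding sum_carrier_block by (intro sum.cong) auto
qed

lemma order_eq_sum: "int (order G) = (\<Sum>i<Suc r. weight i)"
  using sum_sym_fun[of "\<lambda>_. 1"] by (simp add: Coset.order_def)

lemma weight_0: "weight 0 = 1"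
  by (simp add: weight_def block_0)

lemma weight_eq:
  assumes "i \<le> r" "i \<noteq> 0"
  shows "weight i = 2 * int (card (conj_class G (x i)))"
proof -
  let ?C = "conj_class G (x i)"
  have C: "?C \<subseteq> carrier G" using assms x_closed conj_class_closed by blast
  have "block i = ?C \<union> m_inv G ` ?C"
    using C by (auto simp: block_def intro!: image_eqI[of _ "m_inv G"])
  moreover have "?C \<inter> m_inv G ` ?C = {}" using not_both assms C by auto
  moreover have "card (m_inv G ` ?C) = card ?C"
    using C by (intro card_image inj_onI) (metis inv_inv subsetD)
  ultimately show ?thesis
    using C finite_subset[OF C fin] by (simp add: weight_def card_Un_disjoint)
qed

lemma odd_class:
  assumes "i \<le> r"
  shows "odd (card (conj_class G (x i)))"
  using card_conj_class_dvd[OF x_closed[OF assms]] odd_order by (metis dvd_trans)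

text \<open>
  The order is \<open>1\<close> plus twice the sum of \<open>r\<close> class sizes, all of them odd; so \<open>(n - 1)/2\<close> and \<open>r\<close> have
  the same parity.
\<close>

lemma n_star_eq: "n_star (order G) = (-1) ^ r * int (order G)"
proof -
  have "int (order G) = 1 + (\<Sum>i<r. 2 * int (card (conj_class G (x (Suc i)))))"
    unfolding order_eq_sum sum.lessThan_Suc_shift weight_0
    by (intro arg_cong2[where f = "(+)"] sum.cong refl) (simp add: weight_eq)
  also have "\<dots> = int (1 + 2 * (\<Sum>i<r. card (conj_class G (x (Suc i)))))"
    by (simp add: sum_distrib_left)
  finally have n: "order G = 1 + 2 * (\<Sum>i<r. card (conj_class G (x (Suc i))))" by linarith
  have "even (\<Sum>i<k. card (conj_class G (x (Suc i)))) \<longleftrightarrow> even k" if "k \<le> r" for k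
    using that by (induction k) (auto simp: odd_class)
  from this[of r] show ?thesis by (simp add: n_star_def n minus_one_power_iff)
qed

lemma coprime_weight:
  assumes "prime q" "2 < q" "coprime q (order G)" "i \<le> r"
  shows "coprime (weight i) (int q)"
proof (cases "i = 0")
  case False
  have "coprime (card (conj_class G (x i))) q"
    using card_conj_class_dvd[OF x_closed[OF assms(4)]] assms(3)
    by (metis coprime_commute coprime_divisors dvd_refl)
  moreover have "coprime 2 (int q)" using assms prime_odd_nat[of q] by simp
  ultimately show ?thesis using False assms by (simp add: weight_eq)
qed (simp add: weight_0)

text \<open>
  The diagonal of the form \<open>(f, g) \<mapsto> conv f g \<one>\<close> on the functions \<open>basis j\<close>; on symmetric functions
  the form is \<open>\<Sum>i. weight i * f (x i) * g (x i)\<close>.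
\<close>

definition skew_weight :: "nat \<Rightarrow> int" where
  "skew_weight j = (if j = 0 then int (order G) else - weight j)"

lemma gram_basis:
  assumes "j \<le> r" "l \<le> r"
  shows "conv (basis j) (basis l) \<one> = (if j = l then skew_weight j else 0)"
proof -
  have conv1: "conv f g \<one> = (\<Sum>y\<in>carrier G. f y * g (inv y))" for f g
    by (simp add: conv_def)
  have mass0: "mass (basis l) = (if l = 0 then int (order G) else 0)" if "l \<le> r" for l
    using mass_skew[OF skew_fun_basis[OF that]] basis_one[OF that] by simp
  consider "j = 0" | "j \<noteq> 0" "l = 0" | "j \<noteq> 0" "l \<noteq> 0" "j \<noteq> l" | "j \<noteq> 0" "j = l" by blast
  then show ?thesis
  proof cases
    case 1
    then show ?thesis using assms mass0[of l] by (auto simp: basis_0 all_one_conv all_one_one skew_weight_def)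
  next
    case 2
    then show ?thesis using assms mass0[of j] by (auto simp: basis_0 conv_all_one)
  next
    case 3
    have "basis j y * basis l (inv y) = 0" if "y \<in> carrier G" for y
    proof -
      have "y \<notin> block j \<or> y \<notin> block l" using block_unique[of j l y] 3 assms by auto
      then show ?thesis using 3 that by (auto simp: basis_def block_def)
    qed
    then have "conv (basis j) (basis l) \<one> = 0" unfolding conv1 by (intro sum.neutral) blast
    then show ?thesis using 3 by simp
  next
    case 4
    have "basis j y * basis j (inv y) = (if y \<in> block j then -1 else 0)" if "y \<in> carrier G" for y
      using that 4 not_both[of j y] not_both[of j "inv y"] assms by (auto simp: basis_def block_def)
    then have "conv (basis j) (basis j) \<one> = (\<Sum>y\<in>carrier G. if y \<in> block j then -1 else 0)"
      by (simp add: conv1)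
    also have "\<dots> = (\<Sum>y\<in>carrier G \<inter> block j. -1)"
      by (rule sum.inter_restrict[OF fin, symmetric])
    also have "carrier G \<inter> block j = block j" by (auto simp: block_def)
    finally show ?thesis using 4 by (simp add: skew_weight_def weight_def)
  qed
qed

end

section \<open>Power maps on the set of classes\<close>

context finite_grp
begin

lemma finite_conj_classes: "finite (conj_classes G)"
  by (simp add: conj_classes_eq)

lemma class_pow_mult:
  assumes "C \<in> conj_classes G"
  shows "class_pow G (a * b) C = class_pow G a (class_pow G b C)"
  using assms by (auto simp: conj_classes_eq class_pow_conj_class int_pow_pow mult.commute)

lemma sign_class_pow_mult:
  assumes "coprime a (int (order G))" "coprime b (int (order G))"
  shows "sign_on (conj_classes G) (class_pow G (a * b)) =
    sign_on (conj_classes G) (class_pow G a) * sign_on (conj_classes G) (class_pow G b)"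
  using sign_on_compose[OF class_pow_bij[OF fin assms(1)] class_pow_bij[OF fin assms(2)] finite_conj_classes]
    class_pow_mult sign_on_cong[of "conj_classes G" "conj_classes G" "class_pow G (a * b)"
      "class_pow G a \<circ> class_pow G b"] by simp

lemma sign_class_pow_cong:
  assumes "[a = b] (mod int (order G))"
  shows "sign_on (conj_classes G) (class_pow G a) = sign_on (conj_classes G) (class_pow G b)"
proof (rule sign_on_cong[OF refl])
  fix C assume "C \<in> conj_classes G"
  then obtain y where "y \<in> carrier G" "C = conj_class G y" by (auto simp: conj_classes_eq)
  then show "class_pow G a C = class_pow G b C"
    using pow_cong[OF _ assms] by (simp add: class_pow_conj_class)
qed

lemma sign_class_pow_one: "sign_on (conj_classes G) (class_pow G 1) = 1"
proof -
  have "class_pow G 1 C = C" if "C \<in> conj_classes G" for C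
    using that by (auto simp: conj_classes_eq class_pow_conj_class)
  then show ?thesis using sign_on_cong[of "conj_classes G" "conj_classes G" "class_pow G 1" "\<lambda>C. C"] by simp
qed

lemma set_inv_set_inv:
  assumes "C \<in> conj_classes G"
  shows "set_inv (set_inv C) = C"
  using assms by (auto simp: conj_classes_eq set_inv_conj_class)

lemma set_inv_conj_classes:
  assumes "C \<in> conj_classes G"
  shows "set_inv C \<in> conj_classes G"
  using assms by (auto simp: conj_classes_eq set_inv_conj_class)

end

section \<open>Existence of representatives\<close>

context odd_grp
begin

lemma real_class_iff:
  assumes "C \<in> conj_classes G"
  shows "set_inv C = C \<longleftrightarrow> C = {\<one>}"
proof
  obtain y where y: "y \<in> carrier G" "C = conj_class G y" using assms by (auto simp: conj_classes_eq)
  assume "set_inv C = C"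
  then have "inv y \<in> conj_class G y"
    using y self_in_conj_class[of "inv y"] by (simp add: set_inv_conj_class)
  then have "y = \<one>" using real_element_trivial y by blast
  then show "C = {\<one>}" using y conj_class_one by simp
qed (auto simp: SET_INV_def)

text \<open>
  Inversion acts without fixed points on the nontrivial classes, so these have a half system.
\<close>

lemma half_reps_exists:
  obtains r x where "half_reps G r x"
proof -
  let ?A = "conj_classes G - {{\<one>}}"
  have tau: "set_inv C \<in> ?A" "set_inv C \<noteq> C" if "C \<in> ?A" for C
  proof -
    show "set_inv C \<noteq> C" using that real_class_iff by blast
    have "set_inv C \<noteq> {\<one>}"
    proof
      assume "set_inv C = {\<one>}"
      then have "set_inv (set_inv C) = {\<one>}" by (simp add: SET_INV_def)
      then show False using that set_inv_set_inv by simp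
    qed
    then show "set_inv C \<in> ?A" using that set_inv_conj_classes by blast
  qed
  have tau2: "set_inv (set_inv C) = C" if "C \<in> ?A" for C using that set_inv_set_inv by blast
  obtain H where H: "H \<inter> (\<lambda>C. set_inv C) ` H = {}" "H \<union> (\<lambda>C. set_inv C) ` H = ?A"
    using half_system_exists[of ?A "\<lambda>C. set_inv C"] tau tau2 finite_conj_classes by (metis finite_Diff)
  define r where "r = card H"
  have "finite H" using H(2) finite_conj_classes by (metis finite_Diff finite_Un)
  then obtain h where h: "bij_betw h {1..r} H" using ex_bij_betw_nat_finite_1 unfolding r_def by blast
  have "\<forall>i\<in>{1..r}. \<exists>y. y \<in> carrier G \<and> h i = conj_class G y"
  proof
    fix i assume "i \<in> {1..r}"
    then have "h i \<in> H" using bij_betwE[OF h] by blast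
    then have "h i \<in> conj_classes G" using H(2) by blast
    then show "\<exists>y. y \<in> carrier G \<and> h i = conj_class G y" by (auto simp: conj_classes_eq)
  qed
  from bchoice[OF this] obtain x' where
    x': "\<And>i. i \<in> {1..r} \<Longrightarrow> x' i \<in> carrier G \<and> h i = conj_class G (x' i)" by blast
  define x where "x = (\<lambda>i. if i = 0 then \<one> else x' i)"
  have x: "x i \<in> carrier G" "h i = conj_class G (x i)" if "i \<in> {1..r}" for i
    using x'[OF that] that by (auto simp: x_def)
  have hA: "h i \<in> H" "h i \<in> ?A" if "i \<in> {1..r}" for i
    using that bij_betwE[OF h] H(2) by blast+
  have mem: "conj_class G y = h i \<or> set_inv (conj_class G y) = h i"
    if "y \<in> carrier G" "y \<in> conj_class G (x i) \<or> inv y \<in> conj_class G (x i)" "i \<in> {1..r}" for y i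
    using that x[OF that(3)] conj_class_absorb[of "x i" y] conj_class_absorb[of "x i" "inv y"]
    by (auto simp: set_inv_conj_class)
  have zero: "j = 0" if "\<one> \<in> conj_class G (x j)" "j \<le> r" for j
  proof (rule ccontr)
    assume "j \<noteq> 0"
    then have j: "j \<in> {1..r}" using that by auto
    then have "h j = {\<one>}" using that(1) x[OF j] conj_class_absorb[of "x j" \<one>] conj_class_one by simp
    then show False using hA[OF j] by simp
  qed
  have "half_reps G r x"
  proof
    show "x 0 = \<one>" by (simp add: x_def)
    show "x i \<in> carrier G" if "i \<le> r" for i using that x[of i] by (cases "i = 0") (auto simp: x_def)
    show "\<exists>i\<le>r. y \<in> conj_class G (x i) \<or> inv y \<in> conj_class G (x i)" if y: "y \<in> carrier G" for y
    proof (cases "conj_class G y = {\<one>}")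
      case True
      then have "y = \<one>" using self_in_conj_class[OF y] by simp
      then show ?thesis by (intro exI[of _ 0]) (simp add: x_def conj_class_one)
    next
      case False
      then have "conj_class G y \<in> H \<union> (\<lambda>C. set_inv C) ` H" using H(2) y by (auto simp: conj_classes_eq)
      then obtain C where "C \<in> H" "conj_class G y = C \<or> conj_class G y = set_inv C" by blast
      moreover from this obtain i where i: "i \<in> {1..r}" "C = h i" using h by (auto simp: bij_betw_def)
      ultimately have "conj_class G y = conj_class G (x i) \<or> conj_class G (inv y) = conj_class G (x i)"
        using x[OF i(1)] y by (auto simp: set_inv_conj_class[symmetric] set_inv_set_inv conj_classes_eq)
      then have "y \<in> conj_class G (x i) \<or> inv y \<in> conj_class G (x i)"
        using self_in_conj_class[OF y] self_in_conj_class[of "inv y"] y by auto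
      then show ?thesis using i(1) by auto
    qed
    show "i = j" if "i \<le> r" "j \<le> r" "y \<in> carrier G"
      "y \<in> conj_class G (x i) \<or> inv y \<in> conj_class G (x i)"
      "y \<in> conj_class G (x j) \<or> inv y \<in> conj_class G (x j)" for i j y
    proof (cases "i = 0 \<or> j = 0")
      case True
      then have "y = \<one>" using that by (auto simp: x_def conj_class_one)
      then show ?thesis using that zero by auto
    next
      case False
      then have ij: "i \<in> {1..r}" "j \<in> {1..r}" using that by auto
      have "h i \<noteq> set_inv (h j)" "h j \<noteq> set_inv (h i)" using H(1) hA(1) ij by blast+
      moreover have "set_inv (set_inv (conj_class G y)) = conj_class G y"
        using that(3) set_inv_set_inv by (auto simp: conj_classes_eq)
      ultimately have "h i = h j" using mem[OF that(3,4) ij(1)] mem[OF that(3,5) ij(2)] by metis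
      then show ?thesis using h ij by (auto simp: bij_betw_def dest: inj_onD)
    qed
  qed
  then show ?thesis using that by blast
qed

end

section \<open>Comparison of determinants\<close>

context half_reps
begin

definition pow_index :: "int \<Rightarrow> nat \<Rightarrow> nat" where
  "pow_index b a = index (x a [^] b)"

text \<open>
  The \<open>b\<close>-th power of the class of \<open>x a\<close> is the class of \<open>x (pow_index b a)\<close> or the inverse of that class;
  this records which.
\<close>

definition pow_sign :: "int \<Rightarrow> nat \<Rightarrow> int" where
  "pow_sign b a = (if x a [^] b \<in> conj_class G (x (pow_index b a)) then 1 else -1)"

lemma pow_index_le: "a \<le> r \<Longrightarrow> pow_index b a \<le> r"
  using index x_closed by (simp add: pow_index_def)

lemma pow_in_block: "a \<le> r \<Longrightarrow> x a [^] b \<in> block (pow_index b a)"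
  using index x_closed by (simp add: pow_index_def)

lemma conj_in_block:
  assumes "i \<le> r" "g \<in> carrier G" "y \<in> block i"
  shows "g \<otimes> y \<otimes> inv g \<in> block i"
  using assms by (auto simp: block_def conj_mem_iff conj_inv)

lemma index_pow:
  assumes k: "k \<le> r" and y: "y \<in> block k"
  shows "index (y [^] (m :: int)) = index (x k [^] m)"
proof -
  have yc: "y \<in> carrier G" using y by (simp add: block_def)
  have *: "index (z [^] m) = index (x k [^] m)" if z: "z \<in> conj_class G (x k)" for z
  proof -
    obtain g where g: "g \<in> carrier G" "z = g \<otimes> x k \<otimes> inv g"
      using z x_closed[OF k] by (auto simp: conj_class_eq)
    then have "z [^] m \<in> block (index (x k [^] m))"
      using conj_in_block index[of "x k [^] m"] x_closed[OF k] by (simp add: conj_int_pow)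
    then show ?thesis using index_eq index[of "x k [^] m"] x_closed[OF k] by simp
  qed
  have "index (inv z) = index z" if "z \<in> carrier G" for z
    using index[OF that] inv_in_block index_eq by blast
  moreover have "(inv y) [^] m = inv (y [^] m)" using yc by (simp add: int_pow_inv)
  ultimately show ?thesis using y *[of y] *[of "inv y"] yc by (auto simp: block_def)
qed

lemma pow_index_inj:
  assumes b: "[int q * b = 1] (mod int (order G))" and "a \<le> r" "c \<le> r" "pow_index b a = pow_index b c"
  shows "a = c"
proof -
  have "a = index (x (pow_index b a) [^] int q)" if "a \<le> r" for a
  proof -
    have "index ((x a [^] b) [^] int q) = index (x (pow_index b a) [^] int q)"
      using index_pow[OF pow_index_le pow_in_block] that by simp
    moreover have "(x a [^] b) [^] int q = x a"
      using pow_inverse_exponents[OF x_closed[OF that], of b "int q"] b by (simp add: mult.commute)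
    ultimately show ?thesis using index_eq x_in_block that by metis
  qed
  then show ?thesis using assms by metis
qed

lemma pow_index_0: "pow_index b 0 = 0"
  using index_eq[of 0 \<one>] block_0 by (simp add: pow_index_def x_0)

text \<open>
  On the skew functions \<open>twist b\<close> is the permutation matrix of \<open>pow_index b\<close> with its rows multiplied by
  the signs \<open>pow_sign b\<close>.
\<close>

lemma coord_twist_basis:
  assumes b: "[int q * b = 1] (mod int (order G))" and "j \<le> r" "c \<le> r"
  shows "coord (twist b (basis j)) c = pow_sign b c * (if pow_index b c = j then 1 else 0)"
proof -
  let ?k = "pow_index b c" and ?y = "x c [^] b"
  have k: "?k \<le> r" and y: "?y \<in> block ?k" "?y \<in> carrier G" "x c \<in> carrier G"
    using assms pow_index_le pow_in_block x_closed by auto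
  have sk: "skew_fun (basis j)" and cf: "class_fun (basis j)"
    using assms skew_fun_basis class_fun_basis by auto
  have "coord (twist b (basis j)) c = pow_sign b c * coord (basis j) ?k"
  proof (cases "c = 0")
    case True
    then have "?k = 0" using pow_index_0 by simp
    then show ?thesis using True self_in_conj_class[of \<one>]
      by (simp add: coord_def pow_sign_def x_0 twist_def)
  next
    case False
    have "?k \<noteq> 0" using pow_index_inj[OF b assms(3), of 0] pow_index_0 False by auto
    have tw: "twist b (basis j) (x c) = basis j ?y" "twist b (basis j) \<one> = basis j \<one>"
      using y by (simp_all add: twist_def)
    show ?thesis
    proof (cases "?y \<in> conj_class G (x ?k)")
      case True
      then show ?thesis using False \<open>?k \<noteq> 0\<close> tw class_fun_x[OF cf True k] by (simp add: coord_def pow_sign_def)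
    next
      case nin: False
      then have "inv ?y \<in> conj_class G (x ?k)" using y by (simp add: block_def)
      then have "basis j (inv ?y) = basis j (x ?k)" using class_fun_x[OF cf _ k] by simp
      moreover have "basis j ?y + basis j (inv ?y) = 2 * basis j \<one>" using sk y by (simp add: skew_fun_def)
      ultimately show ?thesis using False \<open>?k \<noteq> 0\<close> tw nin by (simp add: coord_def pow_sign_def)
    qed
  qed
  then show ?thesis using coord_basis[OF assms(2) k] by simp
qed

text \<open>
  The matrices of \<open>det_cong_if_twisted_similitude\<close> are \<open>M\<close> for multiplication by \<open>e\<close> from skew to symmetric
  functions, \<open>L\<close> for multiplication by \<open>e\<^sup>2\<close> on skew functions, \<open>P\<close> for the Frobenius map on symmetric
  functions and \<open>S * P\<close> for it on skew functions, where \<open>S\<close> holds the signs.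
\<close>

lemma prod_pow_sign_cong_if_regular:
  assumes q: "prime q" "2 < q" "coprime q (order G)" and b: "[int q * b = 1] (mod int (order G))"
    and \<iota>: "antisym_fun \<iota>"
      "\<And>z y. antisym_fun z \<Longrightarrow> (\<And>y. [conv \<iota> z y = 0] (mod int q)) \<Longrightarrow> [z y = 0] (mod int q)"
  shows "[(\<Prod>a<Suc r. pow_sign b a) = n_star (order G) ^ ((q - 1) div 2)] (mod int q)"
proof -
  define N where "N = Suc r"
  define k where "k = (q - 1) div 2"
  have qk: "q = Suc (2 * k)" using q prime_odd_nat[of q] by (auto simp: k_def elim!: oddE)
  define e where "e = (\<lambda>y. all_one y + \<iota> y)"
  have "\<iota> \<one> = 0" using \<iota>(1) by (force simp: antisym_fun_def)
  then have e: "skew_fun e" "e \<one> = 1"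
    using \<iota>(1) class_fun_all_one class_fun_add
    by (auto simp: skew_fun_def antisym_fun_def e_def all_one_def)
  have cf_e: "class_fun e" using e by (simp add: skew_fun_def)
  have sk: "skew_fun (basis j)" and cf: "class_fun (basis j)" if "j < N" for j
    using that skew_fun_basis class_fun_basis by (auto simp: N_def)
  have sym_e_basis: "sym_fun (conv e (basis j))" if "j < N" for j
    using sym_fun_conv_skew[OF e(1) sk[OF that]] .
  have xc: "x a \<in> carrier G" if "a < N" for a using that x_closed by (simp add: N_def)
  define t where "t = conv e e"
  have t: "sym_fun t" "class_fun t"
    using sym_fun_conv_skew[OF e(1) e(1)] by (auto simp: t_def sym_fun_def)
  define M where "M = mat N N (\<lambda>(a, j). conv e (basis j) (x a))"
  define L where "L = mat N N (\<lambda>(d, c). coord (conv t (basis c)) d)"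
  define P where "P = mat N N (\<lambda>(a, c). if c = pow_index b a then 1 else (0 :: int))"
  define S where "S = mat N N (\<lambda>(a, c). if a = c then pow_sign b a else 0)"
  define K where "K = mat N N (\<lambda>(a, c). if a = c then weight a else 0)"
  define Gm where "Gm = mat N N (\<lambda>(a, c). if a = c then skew_weight a else 0)"
  note mats = M_def L_def P_def S_def K_def Gm_def
  have car: "M \<in> carrier_mat N N" "L \<in> carrier_mat N N" "P \<in> carrier_mat N N" "S \<in> carrier_mat N N"
    "K \<in> carrier_mat N N" "Gm \<in> carrier_mat N N" by (simp_all add: mats)

  \<comment> \<open>The function whose coordinates are column \<open>j\<close> of \<open>A\<close>. Through it the relations between functions
     become relations between matrices.\<close>
  define comb where "comb = (\<lambda>A j y. \<Sum>c<N. A $$ (c, j) * basis c y)"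
  have comb_L: "conv t (basis c) = (\<lambda>y. \<Sum>d<N. L $$ (d, c) * basis d y)" if "c < N" for c
    using skew_fun_expand[OF skew_fun_conv_sym[OF t(1) sk[OF that]]] that by (simp add: L_def N_def)
  have comb_SP: "twist b (basis j) = comb (S * P) j" if "j < N" for j
  proof -
    have "(S * P) $$ (c, j) = coord (twist b (basis j)) c" if c: "c < N" for c
    proof -
      have "(S * P) $$ (c, j) = (\<Sum>d<N. S $$ (c, d) * P $$ (d, j))"
        using c \<open>j < N\<close> car by (intro index_mult_mat_sum)
      also have "\<dots> = (\<Sum>d<N. if c = d then pow_sign b c * (if j = pow_index b c then 1 else 0) else 0)"
        using c \<open>j < N\<close> by (intro sum.cong refl) (simp add: S_def P_def)
      also have "\<dots> = pow_sign b c * (if j = pow_index b c then 1 else 0)" using c by simp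
      finally show ?thesis using coord_twist_basis[OF b, of j c] c \<open>j < N\<close> by (auto simp: N_def)
    qed
    then show ?thesis
      using skew_fun_expand[OF skew_fun_twist[OF sk[OF that], of b]] by (simp add: comb_def N_def)
  qed
  have comb_mult: "conv t (comb A j) = comb (L * A) j" if A: "A \<in> carrier_mat N N" and j: "j < N" for A j
  proof
    fix y
    have "conv t (comb A j) y = (\<Sum>c<N. A $$ (c, j) * (\<Sum>d<N. L $$ (d, c) * basis d y))"
      using comb_L unfolding comb_def conv_sum_right by simp
    also have "\<dots> = (\<Sum>d<N. \<Sum>c<N. L $$ (d, c) * A $$ (c, j) * basis d y)"
      unfolding sum_distrib_left by (subst sum.swap) (simp add: mult_ac)
    also have "\<dots> = comb (L * A) j y"
      using A j car by (simp add: comb_def index_mult_mat_sum[of _ N] sum_distrib_right del: index_mult_mat)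
    finally show "conv t (comb A j) y = comb (L * A) j y" .
  qed
  have comb_pow: "conv (cpow t m) (comb A j) = comb (L ^\<^sub>m m * A) j"
    if "A \<in> carrier_mat N N" "j < N" for A j m
    using that(1)
  proof (induction m arbitrary: A)
    case 0
    have "class_fun (comb A j)" unfolding comb_def by (intro class_fun_sum cf) auto
    then show ?case using 0 car
      by (simp add: conv_commute[OF class_fun_delta] conv_delta_right)
  next
    case (Suc m)
    have "conv (cpow t (Suc m)) (comb A j) = conv (cpow t m) (conv t (comb A j))"
      unfolding cpow_Suc conv_assoc by (rule conv_left_commute[OF t(2)])
    also have "\<dots> = comb (L ^\<^sub>m m * (L * A)) j"
      using comb_mult[OF Suc.prems that(2)] Suc.IH[of "L * A"] Suc.prems car by simp
    also have "L ^\<^sub>m m * (L * A) = L ^\<^sub>m Suc m * A"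
      using Suc.prems car assoc_mult_mat[of "L ^\<^sub>m m" N N L N A N] by simp
    finally show ?case .
  qed
  have comb_M: "conv e (comb A j) (x a) = (M * A) $$ (a, j)"
    if "A \<in> carrier_mat N N" "j < N" "a < N" for A j a
  proof -
    have "(M * A) $$ (a, j) = (\<Sum>c<N. M $$ (a, c) * A $$ (c, j))"
      using that car by (intro index_mult_mat_sum)
    also have "\<dots> = (\<Sum>c<N. A $$ (c, j) * conv e (basis c) (x a))"
      using that by (intro sum.cong) (simp_all add: M_def)
    finally show ?thesis unfolding comb_def conv_sum_right by simp
  qed
  have frob: "[(P * M) $$ (a, j) = (M * (L ^\<^sub>m k * (S * P))) $$ (a, j)] (mod int q)"
    if a: "a < N" and j: "j < N" for a j
  proof -
    have pa: "pow_index b a < N" using pow_index_le[of a b] a by (simp add: N_def)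
    have "(P * M) $$ (a, j) = (\<Sum>c<N. P $$ (a, c) * M $$ (c, j))"
      using a j car by (intro index_mult_mat_sum)
    also have "\<dots> = (\<Sum>c<N. if c = pow_index b a then conv e (basis j) (x c) else 0)"
      using a j by (intro sum.cong refl) (simp add: P_def M_def)
    also have "\<dots> = conv e (basis j) (x (pow_index b a))" using pa by simp
    also have "\<dots> = twist b (conv e (basis j)) (x a)"
      using sym_fun_x[OF sym_e_basis[OF j], of "x a [^] b" "pow_index b a"] xc[OF a]
      by (simp add: twist_def pow_index_def)
    finally have 1: "(P * M) $$ (a, j) = twist b (conv e (basis j)) (x a)" .
    have "[twist b (conv e (basis j)) (x a) = cpow (conv e (basis j)) q (x a)] (mod int q)"
      by (rule cong_sym[OF frobenius[OF class_fun_conv[OF cf_e cf[OF j]] q(1,3) b]])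
    also have "cpow (conv e (basis j)) q (x a) = conv (cpow e q) (cpow (basis j) q) (x a)"
      by (simp only: cpow_conv[OF cf_e cf[OF j]])
    also have "[\<dots> = conv (cpow e q) (twist b (basis j)) (x a)] (mod int q)"
      by (intro conv_cong_mod_right frobenius[OF cf[OF j] q(1,3) b])
    also have "conv (cpow e q) (twist b (basis j)) = conv e (comb (L ^\<^sub>m k * (S * P)) j)"
      using comb_SP[OF j] comb_pow[of "S * P" j k] j car
      by (simp add: qk cpow_double[OF cf_e] conv_assoc t_def)
    also have "conv e (comb (L ^\<^sub>m k * (S * P)) j) (x a) = (M * (L ^\<^sub>m k * (S * P))) $$ (a, j)"
      using a j car by (intro comb_M) auto
    finally show ?thesis unfolding 1 .
  qed
  have gram: "M\<^sup>T * K * M = Gm * L"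
  proof (rule eq_matI)
    fix j l assume "j < dim_row (Gm * L)" "l < dim_col (Gm * L)"
    then have jl: "j < N" "l < N" using car by auto
    have MK: "(M\<^sup>T * K) $$ (j, a) = weight a * M $$ (a, j)" if "a < N" for a
    proof -
      have "(M\<^sup>T * K) $$ (j, a) = (\<Sum>c<N. M\<^sup>T $$ (j, c) * K $$ (c, a))"
        using jl that car by (intro index_mult_mat_sum) auto
      also have "\<dots> = (\<Sum>c<N. if c = a then weight a * M $$ (a, j) else 0)"
        using jl that car by (intro sum.cong refl) (simp add: K_def)
      finally show ?thesis using that by simp
    qed
    let ?f = "\<lambda>j. conv e (basis j)"
    have "(M\<^sup>T * K * M) $$ (j, l) = (\<Sum>a<N. (M\<^sup>T * K) $$ (j, a) * M $$ (a, l))"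
      using jl car by (intro index_mult_mat_sum) auto
    also have "\<dots> = (\<Sum>a<N. weight a * (?f j (x a) * ?f l (x a)))"
      using jl MK by (intro sum.cong refl) (simp add: M_def mult.assoc)
    also have "\<dots> = (\<Sum>y\<in>carrier G. ?f j y * ?f l y)"
    proof -
      have fx: "?f j y = ?f j (x i)" if "j < N" "i \<le> r" "y \<in> block i" for j i y
      proof -
        have "y \<in> carrier G" "i = index y" using that index_eq by (simp_all add: block_def)
        then show ?thesis by (rule sym_fun_x[OF sym_e_basis[OF that(1)]])
      qed
      have "?f j y * ?f l y = ?f j (x i) * ?f l (x i)" if "i \<le> r" "y \<in> block i" for i y
        by (simp only: fx[OF jl(1) that] fx[OF jl(2) that])
      then show ?thesis unfolding N_def by (intro sum_sym_fun[symmetric])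
    qed
    also have "\<dots> = conv (?f j) (?f l) \<one>"
      using sym_e_basis[OF jl(2)] by (simp add: conv_def sym_fun_def)
    also have "conv (?f j) (?f l) = conv (basis j) (conv t (basis l))"
      unfolding t_def conv_assoc by (rule conv_left_commute[OF cf_e])
    also have "conv (basis j) (conv t (basis l)) \<one> = (\<Sum>d<N. L $$ (d, l) * conv (basis j) (basis d) \<one>)"
      unfolding comb_L[OF jl(2)] conv_sum_right ..
    also have "\<dots> = (\<Sum>d<N. if d = j then skew_weight j * L $$ (j, l) else 0)"
      using jl by (intro sum.cong) (auto simp: gram_basis N_def)
    also have "\<dots> = skew_weight j * L $$ (j, l)" using jl by simp
    also have "\<dots> = (Gm * L) $$ (j, l)"
    proof -
      have "(Gm * L) $$ (j, l) = (\<Sum>c<N. Gm $$ (j, c) * L $$ (c, l))"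
        using jl car by (intro index_mult_mat_sum)
      also have "\<dots> = (\<Sum>c<N. if c = j then skew_weight j * L $$ (j, l) else 0)"
        using jl by (intro sum.cong refl) (simp add: Gm_def)
      finally show ?thesis using jl by simp
    qed
    finally show "(M\<^sup>T * K * M) $$ (j, l) = (Gm * L) $$ (j, l)" .
  qed (use car in auto)
  have perm: "P * P\<^sup>T = 1\<^sub>m N"
  proof (rule eq_matI)
    fix a c assume "a < dim_row (1\<^sub>m N :: int mat)" "c < dim_col (1\<^sub>m N :: int mat)"
    then have ac: "a < N" "c < N" by auto
    have pa: "pow_index b a < N" using pow_index_le[of a b] ac by (simp add: N_def)
    have "(P * P\<^sup>T) $$ (a, c) = (\<Sum>d<N. P $$ (a, d) * P\<^sup>T $$ (d, c))"
      using ac car by (intro index_mult_mat_sum) auto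
    also have "\<dots> = (\<Sum>d<N. if d = pow_index b a then (if pow_index b a = pow_index b c then 1 else 0) else 0)"
      using ac by (intro sum.cong refl) (simp add: P_def)
    also have "\<dots> = (if pow_index b a = pow_index b c then 1 else 0)" using pa by simp
    also have "pow_index b a = pow_index b c \<longleftrightarrow> a = c" using pow_index_inj[OF b] ac by (auto simp: N_def)
    finally show "(P * P\<^sup>T) $$ (a, c) = 1\<^sub>m N $$ (a, c)" using ac by simp
  qed (use car in auto)
  have regular: "coprime (det M) (int q)"
  proof (rule coprime_det_if_injective[OF car(1)])
    show "int q > 0" using q by simp
    fix v :: "nat \<Rightarrow> int" and j
    assume v: "\<And>i. i < N \<Longrightarrow> [(\<Sum>j<N. M $$ (i, j) * v j) = 0] (mod int q)" and j: "j < N"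
    \<comment> \<open>A vector in the kernel of \<open>M\<close> modulo \<open>q\<close> is a skew function \<open>w\<close> annihilated by \<open>e\<close>. Summing over the
       group removes its constant part, and regularity of \<open>\<iota>\<close> removes the rest.\<close>
    define w where "w = (\<lambda>y. \<Sum>j<N. v j * basis j y)"
    have cw: "class_fun w" unfolding w_def by (intro class_fun_sum cf) auto
    have w: "skew_fun w"
    proof -
      have "w y + w (inv y) = 2 * w \<one>" if "y \<in> carrier G" for y
      proof -
        have "w y + w (inv y) = (\<Sum>j<N. v j * (basis j y + basis j (inv y)))"
          by (simp add: w_def sum.distrib distrib_left)
        also have "\<dots> = (\<Sum>j<N. 2 * (v j * basis j \<one>))"
          using that sk by (intro sum.cong) (simp_all add: skew_fun_def)
        finally show ?thesis by (simp add: w_def sum_distrib_left)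
      qed
      then show ?thesis using cw by (simp add: skew_fun_def)
    qed
    have coord_w: "coord w c = v c" if "c < N" for c
    proof -
      have "coord w c = (\<Sum>j<N. v j * coord (basis j) c)"
        by (simp add: coord_def w_def sum_subtractf right_diff_distrib)
      also have "\<dots> = (\<Sum>j<N. if j = c then v c else 0)"
        using that by (intro sum.cong) (auto simp: coord_basis N_def)
      finally show ?thesis using that by simp
    qed
    have ew: "conv e w y = (\<Sum>j<N. v j * conv e (basis j) y)" for y
      unfolding w_def conv_sum_right ..
    have ew_x: "[conv e w (x a) = 0] (mod int q)" if "a < N" for a
    proof -
      have "conv e w (x a) = (\<Sum>j<N. M $$ (a, j) * v j)"
        unfolding ew using that by (intro sum.cong refl) (simp add: M_def)
      then show ?thesis using v[OF that] by simp
    qed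
    have ew0: "[conv e w y = 0] (mod int q)" for y
    proof (cases "y \<in> carrier G")
      case True
      then show ?thesis
        using sym_fun_x[OF sym_fun_conv_skew[OF e(1) w] True refl] ew_x[of "index y"] index[OF True]
        by (simp add: N_def)
    qed simp
    have "mass (conv e w) = (int (order G))\<^sup>2 * w \<one>"
      using e w by (simp add: mass_conv mass_skew power2_eq_square)
    moreover have "[mass (conv e w) = (\<Sum>y\<in>carrier G. 0)] (mod int q)"
      unfolding mass_def by (intro cong_sum ew0)
    ultimately have "[(int (order G))\<^sup>2 * w \<one> = (int (order G))\<^sup>2 * 0] (mod int q)" by simp
    moreover have "coprime ((int (order G))\<^sup>2) (int q)" using q(3) by (simp add: coprime_commute)
    ultimately have w1: "[w \<one> = 0] (mod int q)" using cong_mult_lcancel by blast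
    define z where "z = (\<lambda>y. w y + (- w \<one>) * all_one y)"
    have z: "antisym_fun z"
    proof -
      have "class_fun z"
        unfolding z_def by (rule class_fun_add[OF cw class_fun_cmult[OF class_fun_all_one]])
      moreover have "z (inv y) = - z y" if "y \<in> carrier G" for y
      proof -
        have "w y + w (inv y) = 2 * w \<one>" using w that by (simp add: skew_fun_def)
        then show ?thesis using that by (simp add: z_def all_one_def)
      qed
      ultimately show ?thesis by (simp add: antisym_fun_def)
    qed
    have "mass z = 0"
    proof -
      have "mass z = mass w + (- w \<one>) * mass all_one"
        by (simp only: mass_def z_def sum.distrib sum_distrib_left)
      then show ?thesis using mass_skew[OF w] by (simp add: mass_all_one)
    qed
    have "[conv \<iota> z y = 0] (mod int q)" for y
    proof -
      have "conv \<iota> z y = conv e z y"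
        using \<open>mass z = 0\<close> by (simp add: e_def conv_add_left all_one_conv)
      also have "\<dots> = conv e w y + (- w \<one>) * (mass e * all_one y)"
        by (simp only: z_def conv_add_right conv_cmult_right conv_all_one)
      also have "[\<dots> = 0 + 0 * (mass e * all_one y)] (mod int q)"
        using w1 by (intro cong_add cong_mult ew0 cong_refl) (simp add: cong_0_iff)
      finally show ?thesis by simp
    qed
    then have z0: "[z y = 0] (mod int q)" for y using \<iota>(2)[OF z] by blast
    have "v j = (if j = 0 then w \<one> else z (x j))"
      using coord_w[OF j] xc[OF j] by (auto simp: coord_def z_def all_one_def)
    then show "[v j = 0] (mod int q)" using w1 z0 by simp
  qed
  have dets: "det K = (\<Prod>a<N. weight a)" "det Gm = (\<Prod>a<N. skew_weight a)" "det S = (\<Prod>a<N. pow_sign b a)"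
    using car by (auto simp: det_diag[of _ N] mats)
  have disc: "det Gm = n_star (order G) * det K"
    unfolding dets N_def prod.lessThan_Suc_shift n_star_eq
    by (simp add: skew_weight_def weight_0 prod_uminus)
  have "coprime (det K) (int q)"
    unfolding dets by (intro prod_coprime_left coprime_weight q) (auto simp: N_def)
  then have "[det S = n_star (order G) ^ ((q - 1) div 2)] (mod int q)"
    using frob unfolding k_def by (intro det_cong_if_twisted_similitude[OF q(1,2) car _ gram perm regular disc])
  then show ?thesis unfolding dets N_def .
qed

lemma prod_pow_sign_cong:
  assumes q: "prime q" "2 < q" "coprime q (order G)" and b: "[int q * b = 1] (mod int (order G))"
  shows "[(\<Prod>a<Suc r. pow_sign b a) = n_star (order G) ^ ((q - 1) div 2)] (mod int q)"
proof -
  obtain \<iota> where "antisym_fun \<iota>"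
    "\<And>z y. antisym_fun z \<Longrightarrow> (\<And>y. [conv \<iota> z y = 0] (mod int q)) \<Longrightarrow> [z y = 0] (mod int q)"
    using regular_antisym_fun_exists[OF q(1,3)] by blast
  then show ?thesis by (rule prod_pow_sign_cong_if_regular[OF q b])
qed

section \<open>The sign of a power map and the discriminant\<close>

definition half_classes :: "'a set set" where
  "half_classes = (\<lambda>i. conj_class G (x i)) ` {1..r}"

lemma class_in_conj_classes: "i \<le> r \<Longrightarrow> conj_class G (x i) \<in> conj_classes G"
  using x_closed by (auto simp: conj_classes_eq)

lemma finite_half_classes: "finite half_classes"
  by (simp add: half_classes_def)

lemma inj_on_half: "inj_on (\<lambda>i. conj_class G (x i)) {1..r}"
proof (rule inj_onI)
  fix i j assume ij: "i \<in> {1..r}" "j \<in> {1..r}" "conj_class G (x i) = conj_class G (x j)"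
  then have "x i \<in> block i" "x i \<in> block j"
    using x_in_block[of i] self_in_conj_class[OF x_closed, of i] by (auto simp: block_def)
  then show "i = j" using block_unique[of i j] ij by simp
qed

lemma half_classes_disjoint: "half_classes \<inter> (\<lambda>C. set_inv C) ` half_classes = {}"
proof (rule ccontr)
  assume "half_classes \<inter> (\<lambda>C. set_inv C) ` half_classes \<noteq> {}"
  then obtain C C' where C: "C \<in> half_classes" "C' \<in> half_classes" "C = set_inv C'" by blast
  obtain i where "i \<in> {1..r}" "C = conj_class G (x i)" using C(1) unfolding half_classes_def by blast
  moreover obtain j where "j \<in> {1..r}" "C' = conj_class G (x j)"
    using C(2) unfolding half_classes_def by blast
  ultimately have ij: "i \<in> {1..r}" "j \<in> {1..r}"
    "conj_class G (x i) = set_inv (conj_class G (x j))" using C(3) by blast+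
  then have "x i \<in> conj_class G (inv (x j))"
    using self_in_conj_class[OF x_closed, of i] x_closed[of j] by (simp add: set_inv_conj_class)
  then have *: "inv (x i) \<in> conj_class G (x j)"
    using ij(2) x_closed[of j] conj_inv by (auto simp: conj_class_eq)
  then have "x i \<in> block j" using ij(1) x_closed[of i] by (simp add: block_def)
  then have "i = j" using block_unique[of i j] x_in_block[of i] ij by simp
  then show False using * not_both[of i "x i"] self_in_conj_class[OF x_closed, of i] ij by auto
qed

lemma half_classes_union: "half_classes \<union> (\<lambda>C. set_inv C) ` half_classes = conj_classes G - {{\<one>}}"
proof (intro equalityI subsetI)
  fix C assume "C \<in> half_classes \<union> (\<lambda>C. set_inv C) ` half_classes"
  then obtain i where i: "i \<in> {1..r}" "C = conj_class G (x i) \<or> C = set_inv (conj_class G (x i))"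
    by (auto simp: half_classes_def)
  have xi: "x i \<in> carrier G" using i x_closed by simp
  have "C \<in> conj_classes G"
    using i class_in_conj_classes[of i] set_inv_conj_classes by auto
  moreover have "C \<noteq> {\<one>}"
  proof
    assume "C = {\<one>}"
    have "x i \<in> C \<or> inv (x i) \<in> C"
      using i(2) self_in_conj_class[OF xi] self_in_conj_class[OF inv_closed[OF xi]]
        set_inv_conj_class[OF xi] by metis
    then have "x i = \<one> \<or> inv (x i) = \<one>" using \<open>C = {\<one>}\<close> by blast
    then have "x i = \<one>" using xi by (metis inv_inv inv_one)
    then have "x i \<in> block 0" using block_0 by simp
    then show False using block_unique[of 0 i "x i"] x_in_block[of i] i by simp
  qed
  ultimately show "C \<in> conj_classes G - {{\<one>}}" by blast
next
  fix C assume C: "C \<in> conj_classes G - {{\<one>}}"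
  then obtain y where y: "y \<in> carrier G" "C = conj_class G y" by (auto simp: conj_classes_eq)
  have i: "index y \<le> r" "y \<in> block (index y)" using index[OF y(1)] by auto
  have "index y \<noteq> 0"
  proof
    assume "index y = 0"
    then have "y = \<one>" using i block_0 by simp
    then show False using C y conj_class_one by simp
  qed
  then have h: "conj_class G (x (index y)) \<in> half_classes" using i by (auto simp: half_classes_def)
  have "y \<in> conj_class G (x (index y)) \<or> inv y \<in> conj_class G (x (index y))" using i by (simp add: block_def)
  then show "C \<in> half_classes \<union> (\<lambda>C. set_inv C) ` half_classes"
  proof
    assume "y \<in> conj_class G (x (index y))"
    then show ?thesis using conj_class_absorb[OF x_closed[OF i(1)]] y h by auto
  next
    assume "inv y \<in> conj_class G (x (index y))"
    then have "set_inv C = conj_class G (x (index y))"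
      using conj_class_absorb[OF x_closed[OF i(1)]] y by (simp add: set_inv_conj_class)
    then have "C = set_inv (conj_class G (x (index y)))" using set_inv_set_inv C by fastforce
    then show ?thesis using h by auto
  qed
qed

lemma card_half_classes: "card half_classes = r"
  using card_image[OF inj_on_half] by (simp add: half_classes_def)

lemma one_class_in: "{\<one>} \<in> conj_classes G"
  using class_in_conj_classes[of 0] by (simp add: x_0 conj_class_one)

text \<open>
  A nontrivial class of the half system stays in it under the power map exactly when its sign is \<open>1\<close>.
\<close>

lemma sign_class_pow:
  assumes b: "[int q * b = 1] (mod int (order G))"
  shows "sign_on (conj_classes G) (class_pow G b) = (\<Prod>a<Suc r. pow_sign b a)"
proof -
  have cop: "coprime b (int (order G))"
    using b by (metis coprime_iff_invertible_int mult.commute)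
  define p where "p = restrict_id (class_pow G b) (conj_classes G)"
  let ?inv = "\<lambda>C. set_inv C"
  have p1: "p permutes conj_classes G"
    unfolding p_def by (rule permutes_restrict_id[OF class_pow_bij[OF fin cop]])
  have p: "p permutes (half_classes \<union> ?inv ` half_classes)"
    unfolding half_classes_union
  proof (rule permutes_superset[OF p1])
    fix C assume "C \<in> conj_classes G - (conj_classes G - {{\<one>}})"
    then have "C = {\<one>}" by blast
    then show "p C = C" using one_class_in by (simp add: p_def restrict_id_def class_pow_def)
  qed
  have "sign_on (conj_classes G) (class_pow G b) = sign p" by (simp add: sign_on_def p_def)
  also have "\<dots> = (\<Prod>h\<in>half_classes. if p h \<in> half_classes then 1 else -1)"
  proof (rule sign_commuting_involution[OF finite_half_classes half_classes_disjoint _ p])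
    fix C assume "C \<in> half_classes"
    then show "set_inv (set_inv C) = C" using half_classes_union set_inv_set_inv by blast
  next
    fix C assume "C \<in> half_classes \<union> ?inv ` half_classes"
    then have C: "C \<in> conj_classes G" using half_classes_union by blast
    then obtain y where "y \<in> carrier G" "C = conj_class G y" by (auto simp: conj_classes_eq)
    then show "p (set_inv C) = set_inv (p C)"
      using C set_inv_conj_classes[OF C]
      by (simp add: p_def restrict_id_def class_pow_conj_class set_inv_conj_class int_pow_inv)
  qed
  also have "\<dots> = (\<Prod>i\<in>{1..r}. if p (conj_class G (x i)) \<in> half_classes then 1 else -1)"
    unfolding half_classes_def by (subst prod.reindex[OF inj_on_half]) simp
  also have "\<dots> = (\<Prod>i\<in>{1..r}. pow_sign b i)"
  proof (intro prod.cong refl)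
    fix i assume i: "i \<in> {1..r}"
    let ?k = "pow_index b i" and ?y = "x i [^] b"
    have xi: "x i \<in> carrier G" using i x_closed by simp
    have k: "?k \<le> r" "?y \<in> block ?k" using pow_index_le[of i b] pow_in_block[of i b] i by auto
    have "?k \<noteq> 0" using pow_index_inj[OF b, of i 0] pow_index_0[of b] i by auto
    have pc: "p (conj_class G (x i)) = conj_class G ?y"
      using class_in_conj_classes[of i] i xi by (simp add: p_def restrict_id_def class_pow_conj_class)
    have "conj_class G ?y \<in> half_classes \<longleftrightarrow> ?y \<in> conj_class G (x ?k)"
    proof
      assume "?y \<in> conj_class G (x ?k)"
      then have "conj_class G ?y = conj_class G (x ?k)" using conj_class_absorb[OF x_closed[OF k(1)]] by simp
      then show "conj_class G ?y \<in> half_classes"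
        using k(1) \<open>?k \<noteq> 0\<close> by (auto simp: half_classes_def)
    next
      assume "conj_class G ?y \<in> half_classes"
      then obtain l where l: "l \<in> {1..r}" "conj_class G ?y = conj_class G (x l)"
        by (auto simp: half_classes_def)
      then have y: "?y \<in> conj_class G (x l)" using self_in_conj_class[of ?y] xi by simp
      then have "?y \<in> block l" using xi by (simp add: block_def)
      then have "l = ?k" using block_unique[of l ?k ?y] k l by simp
      then show "?y \<in> conj_class G (x ?k)" using y by simp
    qed
    then show "(if p (conj_class G (x i)) \<in> half_classes then 1 else -1) = pow_sign b i"
      unfolding pc pow_sign_def by simp
  qed
  also have "\<dots> = (\<Prod>a<Suc r. pow_sign b a)"
  proof -
    have "{..<Suc r} = insert 0 {1..r}" by auto
    moreover have "pow_sign b 0 = 1" using pow_index_0[of b] by (simp add: pow_sign_def x_0 conj_class_one)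
    ultimately show ?thesis by simp
  qed
  finally show ?thesis .
qed

text \<open>
  The determinants compute the sign of the power map for the inverse \<open>b\<close> of \<open>q\<close> modulo the group order,
  which is the sign of the inverse permutation.
\<close>

lemma group_quad_symbol_prime:
  assumes q: "prime q" "2 < q" "\<not> q dvd order G"
  shows "group_quad_symbol G (int q) = Legendre (n_star (order G)) (int q)"
proof -
  have cop: "coprime q (order G)" using q by (simp add: prime_imp_coprime_nat)
  obtain b where b: "[int q * b = 1] (mod int (order G))" using inverse_exponent[OF cop] .
  have copq: "coprime (int q) (int (order G))" using cop by simp
  have copb: "coprime b (int (order G))" using b by (metis coprime_iff_invertible_int mult.commute)
  let ?s = "\<lambda>a. sign_on (conj_classes G) (class_pow G a)"
  have "?s (int q) * ?s b = 1"
    using sign_class_pow_mult[OF copq copb] sign_class_pow_cong[OF b] sign_class_pow_one by simp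
  then have sqb: "?s (int q) = ?s b"
    by (metis mult.assoc mult.left_neutral mult.right_neutral sign_idempotent sign_on_def)
  have "[?s b = n_star (order G) ^ ((q - 1) div 2)] (mod int q)"
    using prod_pow_sign_cong[OF q(1,2) cop b] sign_class_pow[OF b] by simp
  moreover have "[Legendre (n_star (order G)) (int q) = n_star (order G) ^ ((q - 1) div 2)] (mod int q)"
    by (rule euler_criterion[OF q(1,2)])
  ultimately have "[?s b = Legendre (n_star (order G)) (int q)] (mod int q)"
    using cong_trans cong_sym by blast
  moreover have "?s b \<in> {-1, 0, 1}" by (cases "restrict_id (class_pow G b) (conj_classes G)" rule: sign_cases) (auto simp: sign_on_def)
  ultimately have "?s b = Legendre (n_star (order G)) (int q)"
    using Legendre_values q(2) by (intro cong_imp_eq_small[of _ _ "int q"]) auto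
  then show ?thesis using sqb copq by (simp add: group_quad_symbol_def)
qed

lemma group_disc_eq: "group_disc G = of_int (n_star (order G))"
proof -
  have real: "real_classes G = {{\<one>}}"
    using real_class_iff one_class_in by (auto simp: real_classes_def)
  have "complex_classes G = half_classes \<union> (\<lambda>C. set_inv C) ` half_classes"
    unfolding half_classes_union using real_class_iff by (auto simp: complex_classes_def)
  moreover have "card ((\<lambda>C. set_inv C) ` half_classes) = r"
  proof -
    have "inj_on (\<lambda>C. set_inv C) half_classes"
      using half_classes_union set_inv_set_inv by (intro inj_onI) (metis Diff_iff UnI1)
    then show ?thesis by (simp add: card_image card_half_classes)
  qed
  ultimately have "card (complex_classes G) = 2 * r"
    using half_classes_disjoint finite_half_classes by (simp add: card_Un_disjoint card_half_classes)
  then show ?thesis by (simp add: group_disc_def real n_star_eq)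
qed

end

section \<open>The quadratic symbol at all integers\<close>

context odd_grp
begin

lemma group_quad_symbol_eq_jacobi:
  assumes "coprime a (int (order G))"
  shows "group_quad_symbol G a = jacobi (order G) a"
proof (rule periodic_character_eq_jacobi[OF odd_order _ _ _ _ assms])
  obtain r x where "half_reps G r x" using half_reps_exists .
  then interpret half_reps G r x .
  show "group_quad_symbol G (int q) = Legendre (n_star (order G)) (int q)"
    if "prime q" "2 < q" "\<not> q dvd order G" for q
    using group_quad_symbol_prime[OF that] .
  show "group_quad_symbol G 1 = 1"
    by (simp add: group_quad_symbol_def sign_class_pow_one)
  show "group_quad_symbol G (a * b) = group_quad_symbol G a * group_quad_symbol G b"
    if "coprime a (int (order G))" "coprime b (int (order G))" for a b
    using that by (simp add: group_quad_symbol_def sign_class_pow_mult)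
  show "group_quad_symbol G a = group_quad_symbol G b" if "[a = b] (mod int (order G))" for a b
    using that sign_class_pow_cong[OF that]
    by (auto simp: group_quad_symbol_def intro: cong_imp_coprime cong_sym)
qed

end

theorem corollary1:
  fixes G :: "('a, 'b) monoid_scheme"
  assumes "group G" and "finite (carrier G)" and "odd (order G)"
  shows "group_disc G = of_int (n_star (order G)) \<and>
    (\<forall>a. group_quad_symbol G a = kronecker (n_star (order G)) a) \<and>
    ((\<forall>a. coprime a (int (order G)) \<longrightarrow> group_quad_symbol G a = 1) \<longleftrightarrow>
      (\<exists>k::nat. order G = k\<^sup>2))"
proof -
  interpret odd_grp G
    using assms by (simp add: odd_grp_def odd_grp_axioms_def finite_grp_def finite_grp_axioms_def)
  obtain r x where "half_reps G r x" using half_reps_exists .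
  then have disc: "group_disc G = of_int (n_star (order G))" by (rule half_reps.group_disc_eq)
  have "group_quad_symbol G a = kronecker (n_star (order G)) a" for a
  proof (cases "coprime a (int (order G))")
    case True
    show ?thesis
    proof (cases "a = 0")
      case zero: True
      then have "order G = 1" using True by simp
      then show ?thesis
        using group_quad_symbol_eq_jacobi[OF True] zero by (simp add: kronecker_def)
    next
      case False
      then show ?thesis
        using True group_quad_symbol_eq_jacobi kronecker_n_star[OF assms(3)] by simp
    qed
  next
    case False
    then show ?thesis
      using kronecker_n_star_not_coprime[OF assms(3)] by (simp add: group_quad_symbol_def)
  qed
  moreover have "(\<forall>a. coprime a (int (order G)) \<longrightarrow> group_quad_symbol G a = 1) \<longleftrightarrow>
      (\<exists>k::nat. order G = k\<^sup>2)"
    using jacobi_trivial_iff[OF assms(3)] group_quad_symbol_eq_jacobi by simp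
  ultimately show ?thesis using disc by blast
qed

end
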